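(* Consider a sequence (indexed by $n\in\mathbb N$) of irreducible reversible Markov chains with finite state spaces, where a superscript $(n)$ denotes the quantity for the $n$th chain. Then: (a) $\big(t_{\mathrm{mix}}^{(\infty)}\big)^{(n)}=\Theta\big(t_{\mathrm{hit}}^{(n)}\big)$ if and only if $t_{\mathrm{rel}}^{(n)}=\Theta\big(t_{\mathrm{hit}}^{(n)}\big)$. (b) $\big(t_{\mathrm{mix}}^{(\infty)}\big)^{(n)}\ll t_{\mathrm{hit}}^{(n)}$ if and only if $t_{\mathrm{rel}}^{(n)}\ll t_{\mathrm{hit}}^{(n)}$. (c) $\big(t_{\mathrm{ave-mix}}^{(2)}\big)^{(n)}=\Theta\big(t_\odot^{(n)}\big)$ if and only if $t_{\mathrm{rel}}^{(n)}=\Theta\big(t_\odot^{(n)}\big)$. (d) $\big(t_{\mathrm{ave-mix}}^{(2)}\big)^{(n)}\ll t_\odot^{(n)}$ if and only if $t_{\mathrm{rel}}^{(n)}\ll t_\odot^{(n)}$.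
   Context: For an irreducible Markov chain with transition matrix $P$ on a finite state space $V$ ($|V|\ge2$), reversible with respect to its stationary distribution $\pi$, let $(X_t)_{t\ge 0}$ be its continuous-time rate 1 version, with heat kernel $H_t:=e^{-t(I-P)}$. The eigenvalues of $I-P$ are $0=\lambda_1<\lambda_2\le\cdots\le\lambda_{|V|}\le2$ and $t_{\mathrm{rel}}:=1/\lambda_2$. $T_y:=\inf\{t\ge0:X_t=y\}$, $t_{\mathrm{hit}}:=\max_{x,y\in V}\mathbb E_x[T_y]$, $t_\odot:=\sum_{y\in V}\pi(y)\mathbb E_\pi[T_y]$. $t_{\mathrm{mix}}^{(\infty)}:=\inf\{t\ge0:\max_{a,b\in V}|H_t(a,b)/\pi(b)-1|\le 1/2\}$ and $t_{\mathrm{ave-mix}}^{(2)}:=\inf\{t\ge0:\sum_{x\in V}H_{2t}(x,x)\le 1+1/4\}$. For positive sequences: $f_n\ll g_n$ means $f_n/g_n\to0$ as $n\to\infty$; $f_n=\Theta(g_n)$ means there is a constant $C>0$ with $C^{-1}g_n\le f_n\le Cg_n$ for all $n$. *)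

theory Defs
  imports "HOL-Probability.Probability"
begin

text \<open>
  A Markov chain on a finite set \<open>V\<close> is given by a kernel \<open>K\<close>, where \<open>K x\<close> is the law of one step
  from \<open>x\<close>; its transition matrix is \<open>P(x, y) = pmf (K x) y\<close>. Matrices indexed by \<open>V\<close> are
  functions \<open>'a \<Rightarrow> 'a \<Rightarrow> real\<close>, of which only the entries in \<open>V \<times> V\<close> are meaningful.
\<close>

primrec mat_pow :: "'a set \<Rightarrow> ('a \<Rightarrow> 'a \<Rightarrow> real) \<Rightarrow> nat \<Rightarrow> 'a \<Rightarrow> 'a \<Rightarrow> real" where
  "mat_pow V A 0 = (\<lambda>x y. if x = y then 1 else 0)"
| "mat_pow V A (Suc k) = (\<lambda>x y. \<Sum>z\<in>V. A x z * mat_pow V A k z y)"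

definition trans_mat :: "('a \<Rightarrow> 'a pmf) \<Rightarrow> 'a \<Rightarrow> 'a \<Rightarrow> real" where
  "trans_mat K x y = pmf (K x) y"

definition laplacian :: "('a \<Rightarrow> 'a pmf) \<Rightarrow> 'a \<Rightarrow> 'a \<Rightarrow> real" where
  "laplacian K x y = (if x = y then 1 else 0) - trans_mat K x y"

definition irreducible_chain :: "'a set \<Rightarrow> ('a \<Rightarrow> 'a pmf) \<Rightarrow> bool" where
  "irreducible_chain V K \<longleftrightarrow> (\<forall>x\<in>V. \<forall>y\<in>V. \<exists>k. mat_pow V (trans_mat K) k x y > 0)"

definition stationary_distribution :: "'a set \<Rightarrow> ('a \<Rightarrow> 'a pmf) \<Rightarrow> 'a pmf \<Rightarrow> bool" where
  "stationary_distribution V K \<pi> \<longleftrightarrow> set_pmf \<pi> \<subseteq> V \<and> bind_pmf \<pi> K = \<pi>"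

definition irreducible_reversible_chain ::
    "'a set \<Rightarrow> ('a \<Rightarrow> 'a pmf) \<Rightarrow> 'a pmf \<Rightarrow> bool" where
  "irreducible_reversible_chain V K \<pi> \<longleftrightarrow>
     finite V \<and> 2 \<le> card V \<and> (\<forall>x\<in>V. set_pmf (K x) \<subseteq> V) \<and>
     irreducible_chain V K \<and> stationary_distribution V K \<pi> \<and>
     (\<forall>x\<in>V. \<forall>y\<in>V. pmf \<pi> x * trans_mat K x y = pmf \<pi> y * trans_mat K y x)"

text \<open>The matrix exponential of \<open>-t (I - P)\<close>, as an entrywise power series.\<close>

definition heat_kernel :: "'a set \<Rightarrow> ('a \<Rightarrow> 'a pmf) \<Rightarrow> real \<Rightarrow> 'a \<Rightarrow> 'a \<Rightarrow> real" where
  "heat_kernel V K t x y = (\<Sum>k. (- t) ^ k / fact k * mat_pow V (laplacian K) k x y)"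

definition is_eigenvalue :: "'a set \<Rightarrow> ('a \<Rightarrow> 'a \<Rightarrow> real) \<Rightarrow> real \<Rightarrow> bool" where
  "is_eigenvalue V A l \<longleftrightarrow>
     (\<exists>f. (\<exists>x\<in>V. f x \<noteq> 0) \<and> (\<forall>x\<in>V. (\<Sum>y\<in>V. A x y * f y) = l * f x))"

text \<open>
  The eigenvalues of \<open>I - P\<close> are \<open>0 = \<lambda>\<^sub>1 < \<lambda>\<^sub>2 \<le> \<dots>\<close>, so \<open>\<lambda>\<^sub>2\<close> is the least positive one.
\<close>

definition spectral_gap :: "'a set \<Rightarrow> ('a \<Rightarrow> 'a pmf) \<Rightarrow> real" where
  "spectral_gap V K = Min {l. is_eigenvalue V (laplacian K) l \<and> 0 < l}"

definition t_rel :: "'a set \<Rightarrow> ('a \<Rightarrow> 'a pmf) \<Rightarrow> real" where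
  "t_rel V K = 1 / spectral_gap V K"

text \<open>
  The rate 1 continuous-time chain. The sample space consists of i.i.d. pairs \<open>(e\<^sub>k, F\<^sub>k)\<close> of an
  exponential holding time of mean 1 and an independent random map \<open>F\<^sub>k : V \<rightarrow> V\<close> whose values
  \<open>F\<^sub>k x\<close> are independent with law \<open>K x\<close>. The jump chain is \<open>Y\<^sub>0 = x\<close>, \<open>Y\<^sub>k\<^sub>+\<^sub>1 = F\<^sub>k Y\<^sub>k\<close>, and
  \<open>X\<^sub>t = Y\<^sub>k\<close> for \<open>e\<^sub>0 + \<dots> + e\<^sub>k\<^sub>-\<^sub>1 \<le> t < e\<^sub>0 + \<dots> + e\<^sub>k\<close>. Almost surely such a \<open>k\<close> exists for every
  \<open>t \<ge> 0\<close>.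
\<close>

definition path_space :: "'a set \<Rightarrow> ('a \<Rightarrow> 'a pmf) \<Rightarrow> (real \<times> ('a \<Rightarrow> 'a)) stream measure" where
  "path_space V K = stream_space
     (density lborel (\<lambda>s. ennreal (exponential_density 1 s)) \<Otimes>\<^sub>M
      measure_pmf (Pi_pmf V undefined K))"

primrec jump_chain :: "'a \<Rightarrow> (real \<times> ('a \<Rightarrow> 'a)) stream \<Rightarrow> nat \<Rightarrow> 'a" where
  "jump_chain x \<omega> 0 = x"
| "jump_chain x \<omega> (Suc k) = snd (\<omega> !! k) (jump_chain x \<omega> k)"

definition jump_time :: "(real \<times> ('a \<Rightarrow> 'a)) stream \<Rightarrow> nat \<Rightarrow> real" where
  "jump_time \<omega> k = (\<Sum>i<k. fst (\<omega> !! i))"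

definition ct_chain :: "'a \<Rightarrow> (real \<times> ('a \<Rightarrow> 'a)) stream \<Rightarrow> real \<Rightarrow> 'a" where
  "ct_chain x \<omega> t = jump_chain x \<omega> (LEAST k. t < jump_time \<omega> (Suc k))"

definition hitting_time :: "'a \<Rightarrow> 'a \<Rightarrow> (real \<times> ('a \<Rightarrow> 'a)) stream \<Rightarrow> ennreal" where
  "hitting_time x y \<omega> = Inf {ennreal t | t. 0 \<le> t \<and> ct_chain x \<omega> t = y}"

text \<open>
  \<open>E\<^sub>x[T\<^sub>y]\<close>. The integral is finite for an irreducible chain on a finite set, so \<^const>\<open>enn2real\<close>
  loses nothing.
\<close>

definition expected_hitting_time :: "'a set \<Rightarrow> ('a \<Rightarrow> 'a pmf) \<Rightarrow> 'a \<Rightarrow> 'a \<Rightarrow> real" where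
  "expected_hitting_time V K x y = enn2real (\<integral>\<^sup>+\<omega>. hitting_time x y \<omega> \<partial>path_space V K)"

definition t_hit :: "'a set \<Rightarrow> ('a \<Rightarrow> 'a pmf) \<Rightarrow> real" where
  "t_hit V K = Max {expected_hitting_time V K x y | x y. x \<in> V \<and> y \<in> V}"

definition expected_hitting_time_from ::
    "'a set \<Rightarrow> ('a \<Rightarrow> 'a pmf) \<Rightarrow> 'a pmf \<Rightarrow> 'a \<Rightarrow> real" where
  "expected_hitting_time_from V K \<mu> y = (\<Sum>x\<in>V. pmf \<mu> x * expected_hitting_time V K x y)"

definition t_odot :: "'a set \<Rightarrow> ('a \<Rightarrow> 'a pmf) \<Rightarrow> 'a pmf \<Rightarrow> real" where
  "t_odot V K \<pi> = (\<Sum>y\<in>V. pmf \<pi> y * expected_hitting_time_from V K \<pi> y)"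

definition t_mix_inf :: "'a set \<Rightarrow> ('a \<Rightarrow> 'a pmf) \<Rightarrow> 'a pmf \<Rightarrow> real" where
  "t_mix_inf V K \<pi> =
     Inf {t. 0 \<le> t \<and> Max {\<bar>heat_kernel V K t a b / pmf \<pi> b - 1\<bar> | a b. a \<in> V \<and> b \<in> V} \<le> 1 / 2}"

definition t_ave_mix_2 :: "'a set \<Rightarrow> ('a \<Rightarrow> 'a pmf) \<Rightarrow> real" where
  "t_ave_mix_2 V K = Inf {t. 0 \<le> t \<and> (\<Sum>x\<in>V. heat_kernel V K (2 * t) x x) \<le> 1 + 1 / 4}"

text \<open>
  For positive sequences. Here the bounds in \<open>f\<^sub>n = \<Theta>(g\<^sub>n)\<close> are required for all \<open>n\<close>, not just
  eventually as in \<^theory>\<open>HOL-Library.Landau_Symbols\<close>.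
\<close>

definition same_order :: "(nat \<Rightarrow> real) \<Rightarrow> (nat \<Rightarrow> real) \<Rightarrow> bool" where
  "same_order f g \<longleftrightarrow> (\<exists>C>0. \<forall>n. inverse C * g n \<le> f n \<and> f n \<le> C * g n)"

definition much_less :: "(nat \<Rightarrow> real) \<Rightarrow> (nat \<Rightarrow> real) \<Rightarrow> bool" where
  "much_less f g \<longleftrightarrow> (\<lambda>n. f n / g n) \<longlonglongrightarrow> 0"

end

theory Submission
  imports Defs
begin

text \<open>
  Let \<open>e\<close> run over an orthonormal basis of \<open>L\<^sup>2(\<pi>)\<close> of eigenfunctions of \<open>I - P\<close> with positive
  eigenvalues \<open>\<lambda>\<^sub>e\<close>. Then \<open>H\<^sub>t(x, y) / \<pi>(y) - 1 = \<Sum>\<^sub>e exp (- \<lambda>\<^sub>e t) e(x) e(y)\<close>, while the first-step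
  equations give \<open>E\<^sub>\<pi>[T\<^sub>y] = \<Sum>\<^sub>e e(y)\<^sup>2 / \<lambda>\<^sub>e\<close> and hence \<open>t\<^sub>\<odot> = \<Sum>\<^sub>e 1 / \<lambda>\<^sub>e\<close>. Since
  \<open>exp (- z) \<le> 2 / z\<^sup>2\<close>, comparing these sums term by term bounds both mixing times above by
  \<open>2 \<surd>(t\<^sub>r\<^sub>e\<^sub>l H)\<close> with \<open>H = t\<^sub>h\<^sub>i\<^sub>t\<close> or \<open>H = t\<^sub>\<odot>\<close>. Both are at least \<open>ln 2 * t\<^sub>r\<^sub>e\<^sub>l\<close>, by the slowest mode in
  the trace of \<open>H\<^sub>t\<close>, and \<open>t\<^sub>r\<^sub>e\<^sub>l \<le> t\<^sub>\<odot> \<le> t\<^sub>h\<^sub>i\<^sub>t\<close>. All four equivalences follow.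
\<close>

subsection \<open>Spectral theorem for matrices symmetric with respect to a weight\<close>

text \<open>The first-variation principle: near \<open>s = 0\<close> the linear term dominates. It
  turns minimality of a Rayleigh quotient into an eigenvalue equation.\<close>

lemma quadratic_nonneg_linear_zero:
  fixes a b :: real
  assumes "\<And>s. 0 \<le> a * s\<^sup>2 + b * s"
  shows "b = 0"
proof (rule ccontr)
  assume b: "b \<noteq> 0"
  \<comment> \<open>Any positive \<open>c > a\<close> makes the quadratic negative at
    \<open>- b / c\<close>; taking \<open>\<bar>a\<bar> + 1\<close> avoids a case split on the sign
    of \<open>a\<close>.\<close>
  define c where "c = \<bar>a\<bar> + 1"
  have c: "c > 0" "a < c" by (auto simp: c_def)
  have "a * (- b / c)\<^sup>2 + b * (- b / c) = (b / c)\<^sup>2 * (a - c)"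
    using c by (simp add: field_simps power2_eq_square)
  also have "\<dots> < 0" using b c by (simp add: mult_pos_neg)
  finally show False using assms[of "- b / c"] by linarith
qed

locale weighted_symmetric =
  fixes V :: "'a set" and p :: "'a \<Rightarrow> real" and A :: "'a \<Rightarrow> 'a \<Rightarrow> real"
  assumes finV: "finite V"
    and p_pos: "x \<in> V \<Longrightarrow> 0 < p x"
    and sym: "x \<in> V \<Longrightarrow> y \<in> V \<Longrightarrow> p x * A x y = p y * A y x"
begin

definition ip :: "('a \<Rightarrow> real) \<Rightarrow> ('a \<Rightarrow> real) \<Rightarrow> real" where
  "ip f g = (\<Sum>x\<in>V. p x * f x * g x)"

definition ap :: "('a \<Rightarrow> real) \<Rightarrow> 'a \<Rightarrow> real" where
  "ap f x = (\<Sum>y\<in>V. A x y * f y)"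

text \<open>For a unit eigenfunction the Rayleigh form is its eigenvalue, so spectral sums can be
  indexed by eigenfunctions and multiplicities are counted automatically.\<close>

definition eigval :: "('a \<Rightarrow> real) \<Rightarrow> real" where
  "eigval e = ip e (ap e)"

definition eigenfamily :: "('a \<Rightarrow> real) set \<Rightarrow> bool" where
  "eigenfamily B \<longleftrightarrow> finite B \<and> (\<forall>e\<in>B. \<forall>x. x \<notin> V \<longrightarrow> e x = 0) \<and>
     (\<forall>e\<in>B. \<forall>e'\<in>B. ip e e' = (if e = e' then 1 else 0)) \<and>
     (\<forall>e\<in>B. \<forall>x\<in>V. ap e x = eigval e * e x)"

lemma ip_commute: "ip f g = ip g f"
  by (simp add: ip_def mult_ac)

lemma ip_cong: "(\<And>x. x \<in> V \<Longrightarrow> f x = f' x) \<Longrightarrow> (\<And>x. x \<in> V \<Longrightarrow> g x = g' x) \<Longrightarrow> ip f g = ip f' g'"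
  by (simp add: ip_def cong: sum.cong)

lemma ap_cong: "(\<And>x. x \<in> V \<Longrightarrow> f x = f' x) \<Longrightarrow> ap f x = ap f' x"
  by (simp add: ap_def cong: sum.cong)

lemma ip_add_left: "ip (\<lambda>x. f x + g x) h = ip f h + ip g h"
  by (simp add: ip_def algebra_simps sum.distrib)

lemma ip_diff_left: "ip (\<lambda>x. f x - g x) h = ip f h - ip g h"
  by (simp add: ip_def algebra_simps sum_subtractf)

lemma ip_scale_left: "ip (\<lambda>x. c * f x) h = c * ip f h"
  by (simp add: ip_def algebra_simps sum_distrib_left)

lemma ip_sum_left: "ip (\<lambda>x. \<Sum>i\<in>I. f i x) h = (\<Sum>i\<in>I. ip (f i) h)"
  unfolding ip_def by (subst sum.swap) (simp add: sum_distrib_left sum_distrib_right)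

lemma ip_add_right: "ip h (\<lambda>x. f x + g x) = ip h f + ip h g"
  by (simp add: ip_def algebra_simps sum.distrib)

lemma ip_diff_right: "ip h (\<lambda>x. f x - g x) = ip h f - ip h g"
  by (simp add: ip_def algebra_simps sum_subtractf)

lemma ip_scale_right: "ip h (\<lambda>x. c * f x) = c * ip h f"
  by (simp add: ip_def algebra_simps sum_distrib_left)

lemma ip_sum_right: "ip h (\<lambda>x. \<Sum>i\<in>I. f i x) = (\<Sum>i\<in>I. ip h (f i))"
  by (subst (1 2) ip_commute) (rule ip_sum_left)

lemma ap_add: "ap (\<lambda>x. f x + g x) y = ap f y + ap g y"
  by (simp add: ap_def algebra_simps sum.distrib)

lemma ap_scale: "ap (\<lambda>x. c * f x) y = c * ap f y"
  by (simp add: ap_def algebra_simps sum_distrib_left)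

lemma ap_sum: "ap (\<lambda>x. \<Sum>i\<in>I. f i x) y = (\<Sum>i\<in>I. ap (f i) y)"
  unfolding ap_def by (subst sum.swap) (simp add: sum_distrib_left)

lemma ap_self_adjoint: "ip (ap f) g = ip f (ap g)"
proof -
  have "ip (ap f) g = (\<Sum>x\<in>V. \<Sum>y\<in>V. (p x * A x y) * f y * g x)"
    by (simp add: ip_def ap_def sum_distrib_left sum_distrib_right mult_ac)
  also have "\<dots> = (\<Sum>x\<in>V. \<Sum>y\<in>V. (p y * A y x) * f y * g x)"
    by (intro sum.cong refl) (simp add: sym)
  also have "\<dots> = (\<Sum>y\<in>V. \<Sum>x\<in>V. (p y * A y x) * f y * g x)"
    by (rule sum.swap)
  also have "\<dots> = ip f (ap g)"
    by (simp add: ip_def ap_def sum_distrib_left sum_distrib_right mult_ac)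
  finally show ?thesis .
qed

lemma ip_self_nonneg: "0 \<le> ip f f"
  unfolding ip_def by (intro sum_nonneg) (metis p_pos less_imp_le mult.assoc mult_nonneg_nonneg zero_le_square)

lemma ip_self_eq_0: "ip f f = 0 \<longleftrightarrow> (\<forall>x\<in>V. f x = 0)"
proof -
  have "ip f f = 0 \<longleftrightarrow> (\<forall>x\<in>V. p x * f x * f x = 0)"
    unfolding ip_def using finV
    by (intro sum_nonneg_eq_0_iff) (metis p_pos less_imp_le mult.assoc mult_nonneg_nonneg zero_le_square)+
  thus ?thesis using p_pos by force
qed

lemma ip_point: "y \<in> V \<Longrightarrow> ip (\<lambda>x. if x = y then c else 0) f = p y * c * f y"
  unfolding ip_def using finV by (subst sum.cong[OF refl, of _ _ "\<lambda>x. if x = y then p y * c * f y else 0"]) auto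

lemma eigenfamilyD:
  assumes "eigenfamily B"
  shows "finite B" "\<And>e x. e \<in> B \<Longrightarrow> x \<notin> V \<Longrightarrow> e x = 0"
    "\<And>e e'. e \<in> B \<Longrightarrow> e' \<in> B \<Longrightarrow> ip e e' = (if e = e' then 1 else 0)"
    "\<And>e x. e \<in> B \<Longrightarrow> x \<in> V \<Longrightarrow> ap e x = eigval e * e x"
  using assms by (auto simp: eigenfamily_def)

section \<open>Bessel's inequality and the size of orthonormal families\<close>

lemma ip_residual:
  assumes B: "eigenfamily B" and e: "e \<in> B"
  shows "ip (\<lambda>x. f x - (\<Sum>e\<in>B. ip f e * e x)) e = 0"
proof -
  have "(\<Sum>e'\<in>B. ip f e' * ip e' e) = (\<Sum>e'\<in>B. if e' = e then ip f e' else 0)"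
    using eigenfamilyD(3)[OF B _ e] by (intro sum.cong) auto
  thus ?thesis
    using e eigenfamilyD(1)[OF B] by (simp add: ip_diff_left ip_sum_left ip_scale_left)
qed

text \<open>Pythagoras: the residual is orthogonal to every member of \<open>B\<close>, hence to the
  projection of \<open>f\<close>.\<close>

lemma bessel:
  assumes B: "eigenfamily B"
  shows "ip (\<lambda>x. f x - (\<Sum>e\<in>B. ip f e * e x)) (\<lambda>x. f x - (\<Sum>e\<in>B. ip f e * e x))
       = ip f f - (\<Sum>e\<in>B. (ip f e)\<^sup>2)"
proof -
  define r where "r = (\<lambda>x. f x - (\<Sum>e\<in>B. ip f e * e x))"
  have "ip (\<lambda>x. \<Sum>e\<in>B. ip f e * e x) r = (\<Sum>e\<in>B. ip f e * ip r e)"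
    by (simp add: ip_sum_left ip_scale_left ip_commute)
  also have "\<dots> = 0" using ip_residual[OF B, of _ f] by (simp add: r_def)
  finally have "ip r r = ip f r"
    by (subst (1) r_def) (simp add: ip_diff_left)
  also have "\<dots> = ip f f - (\<Sum>e\<in>B. (ip f e)\<^sup>2)"
    by (simp add: r_def ip_diff_right ip_sum_right ip_scale_right power2_eq_square)
  finally show ?thesis by (simp add: r_def)
qed

text \<open>A dimension bound by double counting. Bessel at the point mass of \<open>x\<close> gives
  \<open>(\<Sum>e\<in>B. p x * e x * e x) \<le> 1\<close>; summed over \<open>x\<close>, the left
  side adds up the squared norms of the members of \<open>B\<close>.\<close>

lemma eigenfamily_card:
  assumes B: "eigenfamily B"
  shows "card B \<le> card V"
proof -
  have "(\<Sum>e\<in>B. p x * e x * e x) \<le> 1" if x: "x \<in> V" for x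
  proof -
    let ?d = "\<lambda>y. if y = x then 1 else 0 :: real"
    have "(\<Sum>e\<in>B. (ip ?d e)\<^sup>2) \<le> ip ?d ?d"
      using bessel[OF B, of ?d] ip_self_nonneg by (smt (verit))
    hence "p x * (\<Sum>e\<in>B. p x * e x * e x) \<le> p x * 1"
      using x by (simp add: ip_point power2_eq_square sum_distrib_left mult_ac)
    thus ?thesis using p_pos[OF x] by (metis mult_le_cancel_left_pos)
  qed
  hence "(\<Sum>x\<in>V. \<Sum>e\<in>B. p x * e x * e x) \<le> (\<Sum>x\<in>V. 1)"
    by (rule sum_mono)
  also have "(\<Sum>x\<in>V. \<Sum>e\<in>B. p x * e x * e x) = (\<Sum>e\<in>B. ip e e)"
    by (subst sum.swap) (simp add: ip_def)
  also have "\<dots> = (\<Sum>e\<in>B. 1)" using eigenfamilyD(3)[OF B] by (intro sum.cong) auto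
  finally show ?thesis by simp
qed

section \<open>Eigenfunctions by minimisation over a compact sphere\<close>

lemma continuous_ip: "continuous_on S (\<lambda>f. ip f g)"
  unfolding ip_def
  by (intro continuous_intros continuous_on_subset[OF continuous_on_product_coordinates]) auto

lemma continuous_ip_self: "continuous_on S (\<lambda>f. ip f f)"
  unfolding ip_def
  by (intro continuous_intros continuous_on_subset[OF continuous_on_product_coordinates]) auto

lemma continuous_rayleigh: "continuous_on S (\<lambda>f. ip f (ap f))"
  unfolding ip_def ap_def
  by (intro continuous_intros continuous_on_subset[OF continuous_on_product_coordinates]) auto

text \<open>The type \<open>'a\<close> may be infinite, so compactness comes from Tychonoff: a unit
  vector vanishing off \<open>V\<close> lies in a product of intervals, with the point 0 as factor
  outside \<open>V\<close>.\<close>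

lemma compact_unit_sphere: "compact {f. (\<forall>x. x \<notin> V \<longrightarrow> f x = 0) \<and> ip f f = 1}"
proof -
  define b where "b = (\<lambda>x. if x \<in> V then {- (1 + 1 / p x) .. 1 + 1 / p x} else {0})"
  have "compactin (product_topology (\<lambda>i. euclidean) UNIV) (PiE UNIV b)"
    by (auto simp: compactin_PiE b_def)
  hence "compact (PiE UNIV b)"
    by (simp add: euclidean_product_topology)
  moreover have "closed {f. ip f f = 1}"
    by (intro closed_Collect_eq continuous_ip_self continuous_intros)
  ultimately have cpt: "compact (PiE UNIV b \<inter> {f. ip f f = 1})"
    by (rule compact_Int_closed)
  have "f \<in> PiE UNIV b" if f: "\<forall>x. x \<notin> V \<longrightarrow> f x = 0" "ip f f = 1" for f
  proof -
    have "\<bar>f x\<bar> \<le> 1 + 1 / p x" if x: "x \<in> V" for x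
    proof -
      have "p x * f x * f x \<le> ip f f"
        unfolding ip_def using x finV
        by (intro member_le_sum) (metis DiffD1 p_pos less_imp_le mult.assoc mult_nonneg_nonneg zero_le_square)+
      hence "\<bar>f x\<bar>\<^sup>2 \<le> 1 / p x"
        using p_pos[OF x] f by (simp add: field_simps power2_eq_square)
      \<comment> \<open>This elementary bound avoids a square root in the radius of the
        intervals.\<close>
      moreover have "2 * \<bar>f x\<bar> \<le> 1 + \<bar>f x\<bar>\<^sup>2"
        using sum_squares_bound[of "\<bar>f x\<bar>" 1] by simp
      moreover have "0 < 1 / p x" using p_pos[OF x] by simp
      ultimately show ?thesis by linarith
    qed
    thus ?thesis using f(1) by (force simp: b_def abs_le_iff)
  qed
  moreover have "f x = 0" if "f \<in> PiE UNIV b" "x \<notin> V" for f x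
    using PiE_mem[OF that(1), of x] that(2) by (auto simp: b_def)
  ultimately have "{f. (\<forall>x. x \<notin> V \<longrightarrow> f x = 0) \<and> ip f f = 1} = PiE UNIV b \<inter> {f. ip f f = 1}"
    by blast
  thus ?thesis using cpt by simp
qed

text \<open>The new eigenfunction minimises the Rayleigh quotient on the orthogonal complement of \<open>B\<close>.\<close>

lemma eigenfamily_extend:
  assumes B: "eigenfamily B" and f0: "\<And>e. e \<in> B \<Longrightarrow> ip f0 e = 0" and nz: "\<exists>x\<in>V. f0 x \<noteq> 0"
  shows "\<exists>e. e \<notin> B \<and> eigenfamily (insert e B)"
proof -
  define C where "C = {f. (\<forall>x. x \<notin> V \<longrightarrow> f x = 0) \<and> ip f f = 1} \<inter> (\<Inter>e\<in>B. {f. ip f e = 0})"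
  have "compact C" unfolding C_def
    by (intro compact_Int_closed compact_unit_sphere closed_INT ballI closed_Collect_eq
        continuous_ip continuous_intros)
  \<comment> \<open>Members of \<open>C\<close> vanish off \<open>V\<close>; cutting a function off
    there changes neither \<open>ip\<close> nor \<open>ap\<close>.\<close>
  define restr where "restr = (\<lambda>g x. if x \<in> V then g x else 0 :: real)"
  have ip_restr: "ip (restr g) h = ip g h" "ip h (restr g) = ip h g" for g h
    by (auto intro!: ip_cong simp: restr_def)
  have ap_restr: "ap (restr g) = ap g" for g
    by (intro ext ap_cong) (auto simp: restr_def)
  have normalise: "restr (\<lambda>x. (1 / sqrt (ip h h)) * h x) \<in> C"
    if h: "\<And>e. e \<in> B \<Longrightarrow> ip h e = 0" and pos: "0 < ip h h" for h
  proof -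
    define c where "c = 1 / sqrt (ip h h)"
    have "c * (c * ip h h) = 1" using pos by (simp add: c_def)
    hence "restr (\<lambda>x. c * h x) \<in> C"
      using h unfolding C_def
      by (auto simp: ip_restr ip_scale_left ip_scale_right) (auto simp: restr_def)
    thus ?thesis by (simp add: c_def)
  qed
  have "0 < ip f0 f0" using nz ip_self_eq_0 ip_self_nonneg by (metis less_eq_real_def)
  hence "C \<noteq> {}" using normalise[OF f0] by auto
  from continuous_attains_inf[OF \<open>compact C\<close> this continuous_rayleigh]
  obtain f where f: "f \<in> C" and min: "\<And>g. g \<in> C \<Longrightarrow> ip f (ap f) \<le> ip g (ap g)" by blast
  have fV: "\<And>x. x \<notin> V \<Longrightarrow> f x = 0" and f1: "ip f f = 1" and fB: "\<And>e. e \<in> B \<Longrightarrow> ip f e = 0"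
    using f by (auto simp: C_def)
  define m where "m = eigval f"
  have rayleigh: "m * ip h h \<le> ip h (ap h)" if h: "\<And>e. e \<in> B \<Longrightarrow> ip h e = 0" for h
  proof (cases "ip h h = 0")
    case True
    hence "ip h (ap h) = ip (\<lambda>_. 0) (ap h)" by (intro ip_cong) (auto simp: ip_self_eq_0)
    also have "\<dots> = 0" by (simp add: ip_def)
    finally show ?thesis using True by simp
  next
    case False
    hence pos: "0 < ip h h" using ip_self_nonneg[of h] by linarith
    define c where "c = 1 / sqrt (ip h h)"
    have c: "c * c = 1 / ip h h" using pos by (simp add: c_def)
    have ap_c: "ap (\<lambda>x. c * h x) = (\<lambda>x. c * ap h x)" by (rule ext) (rule ap_scale)
    have "m \<le> ip (restr (\<lambda>x. c * h x)) (ap (restr (\<lambda>x. c * h x)))"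
      using min[OF normalise[OF h pos]] by (simp add: m_def eigval_def c_def)
    also have "\<dots> = (c * c) * ip h (ap h)"
      unfolding ap_restr ip_restr ap_c
      by (simp add: ip_scale_left ip_scale_right)
    finally show ?thesis using pos by (simp add: c field_simps)
  qed
  \<comment> \<open>The defect in the eigenvalue equation. Self-adjointness makes it orthogonal to
    \<open>B\<close>, so every \<open>f + s * g\<close> satisfies the Rayleigh inequality.\<close>
  define g where "g = (\<lambda>x. ap f x - m * f x)"
  have gB: "ip g e = 0" if e: "e \<in> B" for e
  proof -
    have "ip (ap f) e = ip f (ap e)" by (rule ap_self_adjoint)
    also have "\<dots> = ip (\<lambda>x. eigval e * e x) f"
      by (subst ip_commute) (rule ip_cong, use eigenfamilyD(4)[OF B e] in auto)
    also have "\<dots> = 0" by (simp add: ip_scale_left ip_commute[of e f] fB[OF e])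
    finally show ?thesis by (simp add: g_def ip_diff_left ip_scale_left fB[OF e])
  qed
  \<comment> \<open>The quadratic in \<open>s\<close> is \<open>ip h (ap h) - m * ip h h\<close> for
    \<open>h = f + s * g\<close>; its constant term vanishes because \<open>f\<close> has norm 1 and
    \<open>m\<close> is its Rayleigh value. The linear coefficient turns out to be
    \<open>2 * ip g g\<close>.\<close>
  have "2 * (ip g (ap f) - m * ip g f) = 0"
  proof (rule quadratic_nonneg_linear_zero)
    fix s
    define h where "h = (\<lambda>x. f x + s * g x)"
    have "ip h e = 0" if "e \<in> B" for e
      by (simp add: h_def ip_add_left ip_scale_left fB gB that)
    from rayleigh[OF this] have r: "m * ip h h \<le> ip h (ap h)" .
    have 1: "ip h h = ip f f + 2 * s * ip g f + s\<^sup>2 * ip g g"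
      by (simp add: h_def ip_add_left ip_add_right ip_scale_left ip_scale_right
          power2_eq_square algebra_simps ip_commute[of f g])
    have ah: "ap h = (\<lambda>x. ap f x + s * ap g x)" by (rule ext) (simp add: h_def ap_add ap_scale)
    have fg: "ip f (ap g) = ip g (ap f)" using ap_self_adjoint[of f g] by (simp add: ip_commute)
    have 2: "ip h (ap h) = m + 2 * s * ip g (ap f) + s\<^sup>2 * ip g (ap g)"
      unfolding ah by (simp add: h_def ip_add_left ip_add_right ip_scale_left ip_scale_right
          power2_eq_square algebra_simps m_def eigval_def fg)
    show "0 \<le> (ip g (ap g) - m * ip g g) * s\<^sup>2 + 2 * (ip g (ap f) - m * ip g f) * s"
      using r f1 by (simp add: 1 2 algebra_simps)
  qed
  moreover have "ip g (ap f) - m * ip g f = ip g g"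
    using ip_diff_right[of g "ap f" "\<lambda>x. m * f x"] by (simp add: ip_scale_right flip: g_def)
  ultimately have "ip g g = 0" by simp
  hence fe: "\<And>x. x \<in> V \<Longrightarrow> ap f x = eigval f * f x"
    by (auto simp: ip_self_eq_0 g_def m_def)
  have fnB: "f \<notin> B" using fB f1 by force
  have Bf: "\<And>e. e \<in> B \<Longrightarrow> ip e f = 0" by (subst ip_commute) (rule fB)
  have "\<forall>e\<in>insert f B. \<forall>e'\<in>insert f B. ip e e' = (if e = e' then 1 else 0)"
    using eigenfamilyD(3)[OF B] f1 fB Bf fnB by auto
  with fnB have "eigenfamily (insert f B)"
    unfolding eigenfamily_def using eigenfamilyD(1,2,4)[OF B] fV fe by auto
  with fnB show ?thesis by blast
qed

text \<open>Take an eigenfamily of maximal size above \<open>B0\<close>. A function not reproduced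
  by it would leave a nonzero residual orthogonal to it, and the family could be extended. Starting
  from \<open>B0\<close> allows the constant function to be prescribed.\<close>

theorem eigenfamily_complete:
  assumes B0: "eigenfamily B0"
  obtains B where "B0 \<subseteq> B" "eigenfamily B"
    "\<And>f x. x \<in> V \<Longrightarrow> f x = (\<Sum>e\<in>B. ip f e * e x)"
proof -
  obtain B where B: "B0 \<subseteq> B \<and> eigenfamily B"
    and max: "\<And>B'. B0 \<subseteq> B' \<and> eigenfamily B' \<Longrightarrow> card B' \<le> card B"
  proof -
    have "\<forall>B. B0 \<subseteq> B \<and> eigenfamily B \<longrightarrow> card B < Suc (card V)"
      using eigenfamily_card by (simp add: less_Suc_eq_le)
    from ex_has_greatest_nat[of "\<lambda>B. B0 \<subseteq> B \<and> eigenfamily B", OF _ this] B0 that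
    show thesis by (metis order_refl)
  qed
  have "f x = (\<Sum>e\<in>B. ip f e * e x)" if x: "x \<in> V" for f x
  proof (rule ccontr)
    assume "f x \<noteq> (\<Sum>e\<in>B. ip f e * e x)"
    hence "\<exists>x\<in>V. f x - (\<Sum>e\<in>B. ip f e * e x) \<noteq> 0" using x by auto
    then obtain e where e: "e \<notin> B" "eigenfamily (insert e B)"
      using eigenfamily_extend[OF conjunct2[OF B] ip_residual[OF conjunct2[OF B]]] by blast
    thus False using max[of "insert e B"] B eigenfamilyD(1)[of B] by (simp add: subset_insertI2)
  qed
  thus thesis using that B by blast
qed

end

subsection \<open>Spectral representation of the heat kernel\<close>

locale reversible_chain =
  fixes V :: "'a set" and K :: "'a \<Rightarrow> 'a pmf" and \<pi> :: "'a pmf"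
  assumes chain: "irreducible_reversible_chain V K \<pi>"
begin

lemma finite_V: "finite V" and card_V: "2 \<le> card V"
  and K_closed: "x \<in> V \<Longrightarrow> set_pmf (K x) \<subseteq> V" and \<pi>_supp: "set_pmf \<pi> \<subseteq> V"
  and detailed_balance: "x \<in> V \<Longrightarrow> y \<in> V \<Longrightarrow> pmf \<pi> x * trans_mat K x y = pmf \<pi> y * trans_mat K y x"
  using chain by (auto simp: irreducible_reversible_chain_def stationary_distribution_def)

lemma trans_mat_nonneg: "0 \<le> trans_mat K x y"
  by (simp add: trans_mat_def)

lemma sum_trans_mat: "x \<in> V \<Longrightarrow> (\<Sum>y\<in>V. trans_mat K x y) = 1"
  unfolding trans_mat_def using finite_V K_closed by (rule sum_pmf_eq_1)

lemma sum_\<pi>: "(\<Sum>x\<in>V. pmf \<pi> x) = 1"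
  using finite_V \<pi>_supp by (rule sum_pmf_eq_1)

text \<open>A positive entry of a power of \<open>P\<close> contains a path of positive transition
  probabilities, along which \<open>Q\<close> is carried from \<open>x\<close> to
  \<open>y\<close>.\<close>

lemma irreducible_induct:
  assumes x: "x \<in> V" and y: "y \<in> V" and Qx: "Q x"
    and step: "\<And>u v. u \<in> V \<Longrightarrow> v \<in> V \<Longrightarrow> Q u \<Longrightarrow> 0 < trans_mat K u v \<Longrightarrow> Q v"
  shows "Q y"
proof -
  obtain k where k: "0 < mat_pow V (trans_mat K) k x y"
    using chain x y unfolding irreducible_reversible_chain_def irreducible_chain_def by blast
  have nonneg: "0 \<le> mat_pow V (trans_mat K) k u v" for k u v
    by (induction k arbitrary: u) (auto intro!: sum_nonneg mult_nonneg_nonneg trans_mat_nonneg)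
  show ?thesis using x Qx k
  proof (induction k arbitrary: x)
    case 0
    thus ?case by (auto split: if_splits)
  next
    case (Suc k)
    from Suc.prems(3) obtain z where z: "z \<in> V" "trans_mat K x z * mat_pow V (trans_mat K) k z y \<noteq> 0"
      using sum.neutral[of V "\<lambda>z. trans_mat K x z * mat_pow V (trans_mat K) k z y"] by force
    hence "0 < trans_mat K x z" "0 < mat_pow V (trans_mat K) k z y"
      using nonneg[of k z y] trans_mat_nonneg[of x z] by auto
    thus ?case using Suc.IH[OF z(1)] step[OF Suc.prems(1) z(1) Suc.prems(2)] by blast
  qed
qed

text \<open>Some state has positive mass, and detailed balance carries positivity across each
  edge.\<close>

lemma \<pi>_pos:
  assumes y: "y \<in> V"
  shows "0 < pmf \<pi> y"
proof -
  obtain x where "x \<in> set_pmf \<pi>" using set_pmf_not_empty by fast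
  hence x: "x \<in> V" "0 < pmf \<pi> x" using \<pi>_supp by (auto simp: pmf_positive)
  show ?thesis
  proof (rule irreducible_induct[of x y "\<lambda>z. 0 < pmf \<pi> z"])
    fix u v assume "u \<in> V" "v \<in> V" "0 < pmf \<pi> u" "0 < trans_mat K u v"
    hence "0 < pmf \<pi> v * trans_mat K v u" by (metis detailed_balance mult_pos_pos)
    thus "0 < pmf \<pi> v" using trans_mat_nonneg by (simp add: zero_less_mult_iff)
  qed (use x y in auto)
qed

section \<open>Reversibility as self-adjointness, and the Dirichlet form\<close>

sublocale weighted_symmetric V "pmf \<pi>" "laplacian K"
  by unfold_locales (auto simp: finite_V \<pi>_pos laplacian_def algebra_simps detailed_balance)

lemma ap_laplacian: "x \<in> V \<Longrightarrow> ap f x = f x - (\<Sum>y\<in>V. trans_mat K x y * f y)"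
proof -
  assume x: "x \<in> V"
  have "ap f x = (\<Sum>y\<in>V. (if y = x then f y else 0) - trans_mat K x y * f y)"
    unfolding ap_def laplacian_def by (intro sum.cong) (auto simp: algebra_simps)
  thus ?thesis using x finite_V by (simp add: sum_subtractf)
qed

text \<open>Expand the square: both diagonal terms equal \<open>ip f f\<close>, one because rows sum
  to 1, the other by detailed balance. The cross term is the inner product of \<open>f\<close> with
  \<open>P f\<close>.\<close>

lemma dirichlet_form:
  "ip f (ap f) = (\<Sum>x\<in>V. \<Sum>y\<in>V. pmf \<pi> x * trans_mat K x y * (f x - f y)\<^sup>2) / 2"
proof -
  define S where "S g = (\<Sum>x\<in>V. \<Sum>y\<in>V. pmf \<pi> x * trans_mat K x y * g x y)" for g :: "'a \<Rightarrow> 'a \<Rightarrow> real"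
  have 1: "S (\<lambda>x y. f x * f x) = ip f f"
    unfolding S_def ip_def
    by (intro sum.cong refl) (simp add: sum_trans_mat mult_ac flip: sum_distrib_left sum_distrib_right)
  have "S (\<lambda>x y. f y * f y) = (\<Sum>y\<in>V. \<Sum>x\<in>V. pmf \<pi> x * trans_mat K x y * (f y * f y))"
    unfolding S_def by (rule sum.swap)
  also have "\<dots> = S (\<lambda>x y. f x * f x)"
    unfolding S_def by (intro sum.cong refl) (metis detailed_balance)
  finally have 2: "S (\<lambda>x y. f y * f y) = ip f f" using 1 by simp
  have 3: "ip f (ap f) = ip f f - S (\<lambda>x y. f x * f y)"
    by (simp add: ip_def S_def ap_laplacian algebra_simps sum_subtractf sum_distrib_left cong: sum.cong)
  have "S (\<lambda>x y. (f x - f y)\<^sup>2) = S (\<lambda>x y. f x * f x) + S (\<lambda>x y. f y * f y) - 2 * S (\<lambda>x y. f x * f y)"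
    by (simp add: S_def power2_eq_square algebra_simps sum.distrib sum_subtractf sum_distrib_left)
  hence "S (\<lambda>x y. (f x - f y)\<^sup>2) = 2 * ip f (ap f)" using 1 2 3 by simp
  thus ?thesis by (simp add: S_def)
qed

lemma dirichlet_form_nonneg: "0 \<le> ip f (ap f)"
  unfolding dirichlet_form by (intro divide_nonneg_pos sum_nonneg mult_nonneg_nonneg trans_mat_nonneg) auto

text \<open>Zero energy forces equal values across every edge, and irreducibility spreads this over
  \<open>V\<close>. This is why 0 is a simple eigenvalue.\<close>

lemma harmonic_constant:
  assumes 0: "ip f (ap f) = 0" and x: "x \<in> V" and y: "y \<in> V"
  shows "f y = f x"
proof (rule irreducible_induct[OF x y, where Q = "\<lambda>z. f z = f x"])
  have nn: "0 \<le> pmf \<pi> x * trans_mat K x y * (f x - f y)\<^sup>2" for x y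
    by (intro mult_nonneg_nonneg trans_mat_nonneg) auto
  fix u v assume u: "u \<in> V" and v: "v \<in> V" and fu: "f u = f x" and P: "0 < trans_mat K u v"
  have "(\<Sum>x\<in>V. \<Sum>y\<in>V. pmf \<pi> x * trans_mat K x y * (f x - f y)\<^sup>2) = 0"
    using 0 unfolding dirichlet_form by simp
  hence "(\<Sum>y\<in>V. pmf \<pi> u * trans_mat K u y * (f u - f y)\<^sup>2) = 0"
    using u by (subst (asm) sum_nonneg_eq_0_iff) (auto intro!: finite_V sum_nonneg nn)
  hence "pmf \<pi> u * trans_mat K u v * (f u - f v)\<^sup>2 = 0"
    using v by (subst (asm) sum_nonneg_eq_0_iff) (auto intro!: finite_V nn)
  thus "f v = f x" using P \<pi>_pos[OF u] fu by simp
qed simp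

section \<open>An eigenbasis containing the constant function\<close>

definition unit :: "'a \<Rightarrow> real" where
  "unit x = (if x \<in> V then 1 else 0)"

lemma ip_unit: "ip f unit = (\<Sum>x\<in>V. pmf \<pi> x * f x)"
  by (simp add: ip_def unit_def)

lemma ap_const: "x \<in> V \<Longrightarrow> ap (\<lambda>_. c) x = 0"
  by (simp add: ap_laplacian sum_trans_mat flip: sum_distrib_right)

lemma ap_unit: "x \<in> V \<Longrightarrow> ap unit x = 0"
  using ap_const[of x 1] ap_cong[of unit "\<lambda>_. 1"] by (simp add: unit_def)

lemma ip_unit_unit: "ip unit unit = 1"
  unfolding ip_unit using sum_\<pi> by (simp add: unit_def)

lemma ip_ap_unit: "ip (ap f) unit = 0"
proof -
  have "ip f (ap unit) = ip f (\<lambda>_. 0)" by (rule ip_cong) (auto simp: ap_unit)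
  thus ?thesis by (simp add: ap_self_adjoint) (simp add: ip_def)
qed

definition eigenbasis :: "('a \<Rightarrow> real) set" where
  "eigenbasis = (SOME B. unit \<in> B \<and> eigenfamily B \<and> (\<forall>f. \<forall>x\<in>V. f x = (\<Sum>e\<in>B. ip f e * e x)))"

text \<open>Removing the constant function leaves exactly the basis elements with positive
  eigenvalue.\<close>

definition modes :: "('a \<Rightarrow> real) set" where
  "modes = eigenbasis - {unit}"

lemma eigenbasis: "unit \<in> eigenbasis" "eigenfamily eigenbasis"
  "x \<in> V \<Longrightarrow> f x = (\<Sum>e\<in>eigenbasis. ip f e * e x)"
proof -
  have "eigval unit = ip (\<lambda>_. 0) unit"
    unfolding eigval_def by (subst ip_commute) (rule ip_cong, auto simp: ap_unit)
  hence "eigenfamily {unit}"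
    using ip_unit_unit by (auto simp: eigenfamily_def unit_def ap_unit ip_def[of "\<lambda>_. 0"])
  then obtain B where "{unit} \<subseteq> B" "eigenfamily B" "\<And>f x. x \<in> V \<Longrightarrow> f x = (\<Sum>e\<in>B. ip f e * e x)"
    by (rule eigenfamily_complete) blast
  hence "\<exists>B. unit \<in> B \<and> eigenfamily B \<and> (\<forall>f. \<forall>x\<in>V. f x = (\<Sum>e\<in>B. ip f e * e x))"
    by blast
  from someI_ex[OF this] show "unit \<in> eigenbasis" "eigenfamily eigenbasis"
    "x \<in> V \<Longrightarrow> f x = (\<Sum>e\<in>eigenbasis. ip f e * e x)"
    unfolding eigenbasis_def by blast+
qed

lemma finite_modes: "finite modes"
  using eigenfamilyD(1)[OF eigenbasis(2)] by (simp add: modes_def)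

lemma sum_eigenbasis: "sum g eigenbasis = g unit + sum g modes"
  unfolding modes_def using eigenfamilyD(1)[OF eigenbasis(2)] eigenbasis(1) by (rule sum.remove)

lemma ip_mode_self: "e \<in> modes \<Longrightarrow> ip e e = 1"
  and ip_mode_unit: "e \<in> modes \<Longrightarrow> ip e unit = 0"
  and ap_mode: "e \<in> modes \<Longrightarrow> x \<in> V \<Longrightarrow> ap e x = eigval e * e x"
  using eigenfamilyD(3,4)[OF eigenbasis(2)] eigenbasis(1) by (auto simp: modes_def)

lemma eigval_unit: "eigval unit = 0"
  unfolding eigval_def by (subst ip_commute) (rule ip_ap_unit)

text \<open>A mode with eigenvalue 0 would be constant on \<open>V\<close>; being orthogonal to
  \<open>unit\<close> it would vanish there, against its norm 1.\<close>

lemma eigval_mode_pos: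
  assumes e: "e \<in> modes"
  shows "0 < eigval e"
proof (rule ccontr)
  assume "\<not> 0 < eigval e"
  hence 0: "ip e (ap e) = 0" using dirichlet_form_nonneg[of e] by (simp add: eigval_def)
  obtain x where x: "x \<in> V" using card_V by fastforce
  have c: "\<And>y. y \<in> V \<Longrightarrow> e y = e x" using harmonic_constant[OF 0 x] .
  have "ip e unit = e x" unfolding ip_unit using c sum_\<pi> by (simp flip: sum_distrib_right)
  hence "ip e e = ip (\<lambda>_. 0) e" by (intro ip_cong) (auto simp: c ip_mode_unit[OF e])
  thus False using ip_mode_self[OF e] by (simp add: ip_def)
qed

lemma expansion: "x \<in> V \<Longrightarrow> f x = ip f unit + (\<Sum>e\<in>modes. ip f e * e x)"
  using eigenbasis(3)[of x f] by (simp add: sum_eigenbasis unit_def)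

text \<open>This is the expansion of the point mass at \<open>y\<close>, evaluated at
  \<open>x\<close>.\<close>

lemma completeness:
  assumes "x \<in> V" "y \<in> V"
  shows "(\<Sum>e\<in>eigenbasis. e x * e y * pmf \<pi> y) = (if x = y then 1 else 0)"
  using eigenbasis(3)[OF assms(1), of "\<lambda>z. if z = y then 1 else 0"] assms(2)
  by (simp add: ip_point mult_ac)

text \<open>Each further factor \<open>I - P\<close> acts on the variable \<open>x\<close> and
  contributes one eigenvalue per basis element.\<close>

lemma mat_pow_laplacian:
  assumes "x \<in> V" "y \<in> V"
  shows "mat_pow V (laplacian K) k x y = (\<Sum>e\<in>eigenbasis. eigval e ^ k * (e x * e y * pmf \<pi> y))"
  using assms(1)
proof (induction k arbitrary: x)
  case 0
  thus ?case using completeness assms(2) by simp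
next
  case (Suc k)
  have "mat_pow V (laplacian K) (Suc k) x y
      = (\<Sum>z\<in>V. laplacian K x z * (\<Sum>e\<in>eigenbasis. eigval e ^ k * (e z * e y * pmf \<pi> y)))"
    using Suc.IH by simp
  also have "\<dots> = (\<Sum>e\<in>eigenbasis. eigval e ^ k * (ap e x * e y * pmf \<pi> y))"
    unfolding ap_def sum_distrib_left sum_distrib_right by (subst sum.swap) (simp add: mult_ac)
  also have "\<dots> = (\<Sum>e\<in>eigenbasis. eigval e ^ Suc k * (e x * e y * pmf \<pi> y))"
    using eigenfamilyD(4)[OF eigenbasis(2) _ Suc.prems] by (intro sum.cong refl) simp
  finally show ?case .
qed

text \<open>The finite sum over the basis commutes with the power series, leaving one exponential
  per basis element; \<open>unit\<close>, with eigenvalue 0, gives the summand 1.\<close>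

lemma heat_kernel_spectral:
  assumes x: "x \<in> V" and y: "y \<in> V"
  shows "heat_kernel V K t x y = pmf \<pi> y * (1 + (\<Sum>e\<in>modes. exp (- (t * eigval e)) * (e x * e y)))"
proof -
  have "(\<lambda>k. (- t) ^ k / fact k * mat_pow V (laplacian K) k x y) =
        (\<lambda>k. \<Sum>e\<in>eigenbasis. (- t * eigval e) ^ k /\<^sub>R fact k * (e x * e y * pmf \<pi> y))"
    by (rule ext, unfold mat_pow_laplacian[OF x y] sum_distrib_left power_mult_distrib)
      (simp add: divide_inverse mult_ac)
  also have "\<dots> sums (\<Sum>e\<in>eigenbasis. exp (- t * eigval e) * (e x * e y * pmf \<pi> y))"
    by (intro sums_sum sums_mult2 exp_converges)
  finally have "heat_kernel V K t x y = (\<Sum>e\<in>eigenbasis. exp (- t * eigval e) * (e x * e y * pmf \<pi> y))"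
    unfolding heat_kernel_def by (rule sums_unique[symmetric])
  thus ?thesis
    using x y by (simp add: sum_eigenbasis eigval_unit unit_def algebra_simps sum_distrib_left)
qed

lemma heat_trace: "(\<Sum>x\<in>V. heat_kernel V K t x x) = 1 + (\<Sum>e\<in>modes. exp (- (t * eigval e)))"
proof -
  have "(\<Sum>x\<in>V. heat_kernel V K t x x)
      = (\<Sum>x\<in>V. pmf \<pi> x) + (\<Sum>x\<in>V. \<Sum>e\<in>modes. exp (- (t * eigval e)) * (pmf \<pi> x * e x * e x))"
    by (simp add: heat_kernel_spectral distrib_left sum.distrib sum_distrib_left mult_ac cong: sum.cong)
  also have "(\<Sum>x\<in>V. \<Sum>e\<in>modes. exp (- (t * eigval e)) * (pmf \<pi> x * e x * e x))
      = (\<Sum>e\<in>modes. exp (- (t * eigval e)) * ip e e)"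
    by (subst sum.swap) (simp add: ip_def sum_distrib_left)
  finally show ?thesis by (simp add: sum_\<pi> ip_mode_self)
qed

text \<open>Without modes every function would be constant on \<open>V\<close>, but a point mass
  separates two states.\<close>

lemma modes_nonempty: "modes \<noteq> {}"
proof
  assume "modes = {}"
  hence c: "\<And>f x. x \<in> V \<Longrightarrow> f x = ip f unit" using expansion by simp
  obtain x y where "x \<in> V" "y \<in> V" "x \<noteq> y"
    using card_V finite_V by (metis card_le_Suc0_iff_eq not_less_eq_eq numeral_2_eq_2)
  thus False using c[of x "\<lambda>z. if z = x then 1 else 0"] c[of y "\<lambda>z. if z = x then 1 else 0"] by simp
qed

text \<open>This shows that the minimum defining \<open>spectral_gap\<close> runs over a finite
  nonempty set.\<close>

lemma positive_eigenvalues: "{l. is_eigenvalue V (laplacian K) l \<and> 0 < l} = eigval ` modes"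
proof (intro equalityI subsetI)
  fix l assume "l \<in> {l. is_eigenvalue V (laplacian K) l \<and> 0 < l}"
  then obtain f where l: "0 < l" and nz: "\<exists>x\<in>V. f x \<noteq> 0" and f: "\<And>x. x \<in> V \<Longrightarrow> ap f x = l * f x"
    by (auto simp: is_eigenvalue_def ap_def)
  have ipf: "ip (ap f) e = l * ip f e" for e
  proof -
    have "ip (ap f) e = ip (\<lambda>x. l * f x) e" by (rule ip_cong) (auto simp: f)
    thus ?thesis by (simp add: ip_scale_left)
  qed
  \<comment> \<open>The range of \<open>I - P\<close> is orthogonal to constants, so an
    eigenfunction with \<open>l > 0\<close> must have a nonzero coefficient on some mode;
    self-adjointness then identifies the two eigenvalues.\<close>
  have "ip f unit = 0" using ipf[of unit] ip_ap_unit l by simp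
  then obtain e where e: "e \<in> modes" "ip f e \<noteq> 0"
    using nz expansion[of _ f] by (metis (no_types, lifting) add_0 mult_zero_left sum.neutral)
  have "l * ip f e = ip f (ap e)" by (simp add: ap_self_adjoint flip: ipf)
  also have "\<dots> = ip f (\<lambda>x. eigval e * e x)" by (rule ip_cong) (auto simp: ap_mode[OF e(1)])
  finally have "l = eigval e" using e(2) by (simp add: ip_scale_right)
  thus "l \<in> eigval ` modes" using e by blast
next
  fix l assume "l \<in> eigval ` modes"
  then obtain e where e: "e \<in> modes" "l = eigval e" by blast
  have "\<exists>x\<in>V. e x \<noteq> 0" using ip_mode_self[OF e(1)] ip_self_eq_0[of e] by force
  thus "l \<in> {l. is_eigenvalue V (laplacian K) l \<and> 0 < l}"
    using e ap_mode[OF e(1)] eigval_mode_pos[OF e(1)] by (auto simp: is_eigenvalue_def ap_def)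
qed

lemma spectral_gap_le: "e \<in> modes \<Longrightarrow> spectral_gap V K \<le> eigval e"
  unfolding spectral_gap_def positive_eigenvalues using finite_modes by simp

lemma spectral_gap_attained: "\<exists>e\<in>modes. eigval e = spectral_gap V K"
  unfolding spectral_gap_def positive_eigenvalues
  using Min_in[of "eigval ` modes"] finite_modes modes_nonempty by fastforce

lemma spectral_gap_pos: "0 < spectral_gap V K"
  using spectral_gap_attained eigval_mode_pos by force

end

subsection \<open>Expected hitting times\<close>

text \<open>
  Summing over \<open>z \<in> V\<close> instead of continuing from \<open>F\<^sub>0 x\<close> keeps the function measurable for an
  uncountable state type. With \<open>c = fst\<close> it approximates the hitting time; with \<open>c = 1\<close> it counts
  jumps, which shows that \<open>y\<close> is reached almost surely.
\<close>

primrec stopped_cost ::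
    "'a set \<Rightarrow> (real \<times> ('a \<Rightarrow> 'a) \<Rightarrow> ennreal) \<Rightarrow> 'a \<Rightarrow> nat \<Rightarrow> 'a \<Rightarrow>
     (real \<times> ('a \<Rightarrow> 'a)) stream \<Rightarrow> ennreal" where
  "stopped_cost V c y 0 x \<omega> = 0"
| "stopped_cost V c y (Suc n) x \<omega> = (if x = y then 0 else c (shd \<omega>) +
     (\<Sum>z\<in>V. if snd (shd \<omega>) x = z then stopped_cost V c y n z (stl \<omega>) else 0))"

lemma stopped_cost_0: "stopped_cost V c y 0 x = (\<lambda>_. 0)"
  by (rule ext) simp

lemma stopped_cost_mono: "stopped_cost V c y n x \<omega> \<le> stopped_cost V c y (Suc n) x \<omega>"
proof (induction n arbitrary: x \<omega>)
  case (Suc n)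
  show ?case
    by (subst (1 2) stopped_cost.simps(2)) (use Suc in \<open>auto intro!: add_left_mono sum_mono\<close>)
qed simp

text \<open>\<open>jump_chain\<close> recurses on the last step, \<open>stopped_cost\<close> on the
  first; this converts between them.\<close>

lemma jump_chain_Suc_shift: "jump_chain x \<omega> (Suc k) = jump_chain (snd (shd \<omega>) x) (stl \<omega>) k"
  by (induction k) auto

section \<open>Pathwise description of the hitting time\<close>

lemma stopped_cost_eq:
  assumes "finite V" "x \<in> V" "\<And>k z. z \<in> V \<Longrightarrow> snd (\<omega> !! k) z \<in> V"
  shows "stopped_cost V c y n x \<omega> =
    (\<Sum>i<n. if \<forall>j\<le>i. jump_chain x \<omega> j \<noteq> y then c (\<omega> !! i) else 0)"
  using assms(2,3)
proof (induction n arbitrary: x \<omega>)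
  case (Suc n)
  define z where "z = snd (shd \<omega>) x"
  have z: "z \<in> V" using Suc.prems(2)[of x 0] Suc.prems(1) by (simp add: z_def)
  have "snd (stl \<omega> !! k) u \<in> V" if "u \<in> V" for u k
    using Suc.prems(2)[OF that, of "Suc k"] by simp
  note IH = Suc.IH[OF z this]
  have split: "(\<forall>j\<le>Suc i. jump_chain x \<omega> j \<noteq> y) \<longleftrightarrow> x \<noteq> y \<and> (\<forall>j\<le>i. jump_chain z (stl \<omega>) j \<noteq> y)" for i
    unfolding z_def jump_chain_Suc_shift[symmetric]
    by (metis Suc_le_mono jump_chain.simps(1) le0 not0_implies_Suc)
  \<comment> \<open>The maps preserve \<open>V\<close>, so exactly one summand, the actual next
    state, survives.\<close>
  have "(\<Sum>u\<in>V. if snd (shd \<omega>) x = u then stopped_cost V c y n u (stl \<omega>) else 0)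
      = stopped_cost V c y n z (stl \<omega>)"
    using z assms(1) by (simp add: z_def)
  thus ?case
    unfolding sum.lessThan_Suc_shift split by (auto simp: IH cong: if_cong)
qed simp

lemma jump_time_strict_mono:
  assumes "\<And>k. 0 < fst (\<omega> !! k)"
  shows "strict_mono (jump_time \<omega>)"
  by (rule strict_monoI_Suc) (simp add: jump_time_def assms)

lemma hitting_time_eq_jump_time:
  assumes pos: "\<And>k. 0 < fst (\<omega> !! k)" and hit: "jump_chain x \<omega> N = y"
    and before: "\<And>j. j < N \<Longrightarrow> jump_chain x \<omega> j \<noteq> y"
  shows "hitting_time x y \<omega> = ennreal (jump_time \<omega> N)"
proof -
  note mono = jump_time_strict_mono[of \<omega>, OF pos]
  \<comment> \<open>Holding intervals are closed on the left, so at the jump time itself the chain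
    is already in its \<open>N\<close>-th state.\<close>
  have "(LEAST k. jump_time \<omega> N < jump_time \<omega> (Suc k)) = N"
    by (rule Least_equality) (simp_all add: strict_mono_less[OF mono])
  hence 1: "ct_chain x \<omega> (jump_time \<omega> N) = y" by (simp add: ct_chain_def hit)
  have nonneg: "0 \<le> jump_time \<omega> N"
    unfolding jump_time_def by (intro sum_nonneg) (simp add: pos less_imp_le)
  have 2: "jump_time \<omega> N \<le> t" if t: "0 \<le> t" "ct_chain x \<omega> t = y" for t
  proof (rule ccontr)
    assume less: "\<not> jump_time \<omega> N \<le> t"
    \<comment> \<open>\<open>N = 0\<close> is excluded since
      \<open>jump_time \<omega> 0 = 0\<close>. Before the \<open>N\<close>-th jump the current index
      is at most \<open>M\<close>, where \<open>y\<close> has not been visited.\<close>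
    then obtain M where M: "N = Suc M" using t(1) by (cases N) (auto simp: jump_time_def)
    have "(LEAST k. t < jump_time \<omega> (Suc k)) \<le> M" by (rule Least_le) (use less M in auto)
    thus False using before[of "LEAST k. t < jump_time \<omega> (Suc k)"] t(2) M by (auto simp: ct_chain_def)
  qed
  show ?thesis unfolding hitting_time_def
  proof (rule antisym)
    show "Inf {ennreal t |t. 0 \<le> t \<and> ct_chain x \<omega> t = y} \<le> ennreal (jump_time \<omega> N)"
      by (rule Inf_lower) (use 1 nonneg in blast)
    show "ennreal (jump_time \<omega> N) \<le> Inf {ennreal t |t. 0 \<le> t \<and> ct_chain x \<omega> t = y}"
      by (rule Inf_greatest) (auto intro!: ennreal_leI 2)
  qed
qed

lemma hitting_time_eq_SUP:
  assumes V: "finite V" "x \<in> V" "\<And>k z. z \<in> V \<Longrightarrow> snd (\<omega> !! k) z \<in> V"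
    and pos: "\<And>k. 0 < fst (\<omega> !! k)"
    and fin: "(SUP n. stopped_cost V (\<lambda>_. 1) y n x \<omega>) \<noteq> \<infinity>"
  shows "hitting_time x y \<omega> = (SUP n. stopped_cost V (\<lambda>p. ennreal (fst p)) y n x \<omega>)"
proof -
  have "\<exists>k. jump_chain x \<omega> k = y"
  proof (rule ccontr)
    assume "\<nexists>k. jump_chain x \<omega> k = y"
    \<comment> \<open>If \<open>y\<close> is never visited, unit cost is charged at each of the
      \<open>n\<close> steps, contradicting the finite supremum.\<close>
    hence "stopped_cost V (\<lambda>_. 1) y n x \<omega> = of_nat n" for n
      by (subst stopped_cost_eq[OF V]) auto
    hence "(SUP n. stopped_cost V (\<lambda>_. 1) y n x \<omega>) = top"
      by (simp only: ennreal_SUP_of_nat_eq_top)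
    thus False using fin by (simp only: infinity_ennreal_def)
  qed
  define N where "N = (LEAST k. jump_chain x \<omega> k = y)"
  have N: "jump_chain x \<omega> N = y" unfolding N_def by (rule LeastI_ex) fact
  have before: "\<And>j. j < N \<Longrightarrow> jump_chain x \<omega> j \<noteq> y" unfolding N_def by (rule not_less_Least)
  have alive: "(\<forall>j\<le>i. jump_chain x \<omega> j \<noteq> y) \<longleftrightarrow> i < N" for i
    using N before by (metis le_less_trans not_less)
  have cost: "stopped_cost V (\<lambda>p. ennreal (fst p)) y n x \<omega> = (\<Sum>i<n. if i < N then ennreal (fst (\<omega> !! i)) else 0)" for n
    by (subst stopped_cost_eq[OF V]) (simp_all only: alive)
  have J: "ennreal (jump_time \<omega> N) = (\<Sum>i<N. ennreal (fst (\<omega> !! i)))"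
    unfolding jump_time_def by (rule sum_ennreal[symmetric]) (simp add: pos less_imp_le)
  have "(SUP n. stopped_cost V (\<lambda>p. ennreal (fst p)) y n x \<omega>) = ennreal (jump_time \<omega> N)"
  proof (rule antisym)
    show "(SUP n. stopped_cost V (\<lambda>p. ennreal (fst p)) y n x \<omega>) \<le> ennreal (jump_time \<omega> N)"
    proof (rule SUP_least)
      fix n
      have "stopped_cost V (\<lambda>p. ennreal (fst p)) y n x \<omega> = (\<Sum>i\<in>{..<n} \<inter> {i. i < N}. ennreal (fst (\<omega> !! i)))"
        unfolding cost by (rule sum.inter_restrict[symmetric, where B = "{i. i < N}", simplified mem_Collect_eq]) simp
      also have "\<dots> \<le> ennreal (jump_time \<omega> N)"
        unfolding J by (rule sum_mono2) auto
      finally show "stopped_cost V (\<lambda>p. ennreal (fst p)) y n x \<omega> \<le> ennreal (jump_time \<omega> N)" .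
    qed
    have "ennreal (jump_time \<omega> N) = stopped_cost V (\<lambda>p. ennreal (fst p)) y N x \<omega>"
      unfolding J cost by (intro sum.cong) auto
    also have "\<dots> \<le> (SUP n. stopped_cost V (\<lambda>p. ennreal (fst p)) y n x \<omega>)"
      by (rule SUP_upper) simp
    finally show "ennreal (jump_time \<omega> N) \<le> (SUP n. stopped_cost V (\<lambda>p. ennreal (fst p)) y n x \<omega>)" .
  qed
  thus ?thesis using hitting_time_eq_jump_time[of \<omega> x N y] pos N before by simp
qed

section \<open>Expectations under the path measure\<close>

context reversible_chain
begin

abbreviation hold_law :: "real measure" where
  "hold_law \<equiv> density lborel (\<lambda>s. ennreal (exponential_density 1 s))"

abbreviation step_law :: "(real \<times> ('a \<Rightarrow> 'a)) measure" where
  "step_law \<equiv> hold_law \<Otimes>\<^sub>M measure_pmf (Pi_pmf V undefined K)"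

lemma prob_space_hold_law: "prob_space hold_law"
  by (rule prob_space_exponential_density) simp

lemma prob_space_step_law: "prob_space step_law"
  by (intro prob_space_pair prob_space_hold_law prob_space_measure_pmf)

lemma nn_integral_step_law_fst:
  assumes [measurable]: "f \<in> borel_measurable borel"
  shows "(\<integral>\<^sup>+p. f (fst p) \<partial>step_law) = (\<integral>\<^sup>+s. f s \<partial>hold_law)"
proof -
  have "(\<integral>\<^sup>+p. f (fst p) \<partial>step_law) = (\<integral>\<^sup>+s. \<integral>\<^sup>+F. f (fst (s, F)) \<partial>measure_pmf (Pi_pmf V undefined K) \<partial>hold_law)"
    by (rule measure_pmf.nn_integral_fst[symmetric]) measurable
  thus ?thesis by simp
qed

lemma nn_integral_step_law_snd:
  "(\<integral>\<^sup>+p. f (snd p) \<partial>step_law) = (\<integral>\<^sup>+F. f F \<partial>measure_pmf (Pi_pmf V undefined K))"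
proof -
  interpret E: prob_space hold_law by (rule prob_space_hold_law)
  have [measurable]: "f \<in> borel_measurable (measure_pmf (Pi_pmf V undefined K))" by simp
  have "(\<integral>\<^sup>+p. f (snd p) \<partial>step_law) = (\<integral>\<^sup>+s. \<integral>\<^sup>+F. f (snd (s, F)) \<partial>measure_pmf (Pi_pmf V undefined K) \<partial>hold_law)"
    by (rule measure_pmf.nn_integral_fst[symmetric]) measurable
  thus ?thesis using E.emeasure_space_1 by simp
qed

lemma nn_integral_hold_law: "(\<integral>\<^sup>+s. ennreal s \<partial>hold_law) = 1"
proof -
  have "(\<integral>\<^sup>+s. ennreal s \<partial>hold_law) = (\<integral>\<^sup>+s. ennreal (exponential_density 1 s) * ennreal s \<partial>lborel)"
    by (rule nn_integral_density) auto
  also have "\<dots> = (\<integral>\<^sup>+s. ennreal (erlang_density 0 1 s * s ^ 1) \<partial>lborel)"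
    by (intro nn_integral_cong) (auto simp: erlang_density_def ennreal_mult' ennreal_mult'')
  also have "\<dots> = 1" by (subst nn_integral_erlang_ith_moment) auto
  finally show ?thesis .
qed

lemma nn_integral_step_target:
  assumes x: "x \<in> V"
  shows "(\<integral>\<^sup>+p. (if snd p x = z then a else 0) \<partial>step_law) = ennreal (trans_mat K x z) * a"
proof -
  have "(\<integral>\<^sup>+p. (if snd p x = z then a else 0) \<partial>step_law)
      = (\<integral>\<^sup>+F. (if F x = z then a else 0) \<partial>measure_pmf (Pi_pmf V undefined K))"
    by (rule nn_integral_step_law_snd)
  also have "\<dots> = (\<integral>\<^sup>+u. (if u = z then a else 0) \<partial>measure_pmf (map_pmf (\<lambda>F. F x) (Pi_pmf V undefined K)))"
    by simp
  also have "\<dots> = (\<integral>\<^sup>+u. a * indicator {z} u \<partial>measure_pmf (K x))"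
    using x finite_V by (subst Pi_pmf_component) (auto intro!: nn_integral_cong simp: indicator_def)
  also have "\<dots> = ennreal (trans_mat K x z) * a"
    by (simp add: nn_integral_cmult emeasure_pmf_single trans_mat_def mult.commute)
  finally show ?thesis .
qed

lemma measurable_stopped_cost [measurable]:
  assumes [measurable]: "c \<in> borel_measurable step_law"
  shows "stopped_cost V c y n x \<in> borel_measurable (stream_space step_law)"
proof (induction n arbitrary: x)
  case (Suc n)
  note Suc[measurable]
  have [measurable]: "(\<lambda>p. snd p x) \<in> measurable step_law (count_space UNIV)"
    by (rule measurable_compose[OF measurable_snd]) simp
  have "stopped_cost V c y (Suc n) x = (\<lambda>\<omega>. if x = y then 0 else c (shd \<omega>) +
     (\<Sum>z\<in>V. if snd (shd \<omega>) x = z then stopped_cost V c y n z (stl \<omega>) else 0))"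
    by (rule ext) simp
  thus ?case by simp
qed (simp add: stopped_cost_0)

text \<open>The expected number of jumps before reaching \<open>y\<close>, truncated at
  \<open>n\<close>.\<close>

primrec approx_hit :: "'a \<Rightarrow> nat \<Rightarrow> 'a \<Rightarrow> real" where
  "approx_hit y 0 x = 0"
| "approx_hit y (Suc n) x = (if x = y then 0 else 1 + (\<Sum>z\<in>V. trans_mat K x z * approx_hit y n z))"

lemma approx_hit_nonneg: "0 \<le> approx_hit y n x"
  by (induction n arbitrary: x) (auto intro!: add_nonneg_nonneg sum_nonneg mult_nonneg_nonneg trans_mat_nonneg)

text \<open>Conditioning on the first pair leaves an independent copy of the stream, and only the
  mean of the cost enters. Hence counting jumps and adding holding times give the same
  expectation.\<close>

lemma nn_integral_stopped_cost:
  assumes c[measurable]: "c \<in> borel_measurable step_law" and c1: "(\<integral>\<^sup>+p. c p \<partial>step_law) = 1" and x: "x \<in> V"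
  shows "(\<integral>\<^sup>+\<omega>. stopped_cost V c y n x \<omega> \<partial>stream_space step_law) = ennreal (approx_hit y n x)"
  using x
proof (induction n arbitrary: x)
  case (Suc n)
  interpret prob_space step_law by (rule prob_space_step_law)
  interpret S: prob_space "stream_space step_law" by (rule prob_space_stream_space)
  have [measurable]: "(\<lambda>p. snd p x) \<in> measurable step_law (count_space UNIV)" for x
    by (rule measurable_compose[OF measurable_snd]) simp
  show ?case
  proof (cases "x = y")
    case False
    have inner: "(\<integral>\<^sup>+\<omega>. stopped_cost V c y (Suc n) x (p ## \<omega>) \<partial>stream_space step_law)
        = c p + (\<Sum>z\<in>V. if snd p x = z then ennreal (approx_hit y n z) else 0)" for p
    proof -
      have "(\<integral>\<^sup>+\<omega>. stopped_cost V c y (Suc n) x (p ## \<omega>) \<partial>stream_space step_law)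
        = (\<integral>\<^sup>+\<omega>. c p + (\<Sum>z\<in>V. if snd p x = z then stopped_cost V c y n z \<omega> else 0) \<partial>stream_space step_law)"
        using False by (simp cong: if_cong)
      also have "\<dots> = c p + (\<Sum>z\<in>V. \<integral>\<^sup>+\<omega>. (if snd p x = z then stopped_cost V c y n z \<omega> else 0) \<partial>stream_space step_law)"
        by (subst nn_integral_add) (auto simp: nn_integral_sum S.emeasure_space_1)
      also have "\<dots> = c p + (\<Sum>z\<in>V. if snd p x = z then ennreal (approx_hit y n z) else 0)"
        by (intro arg_cong2[where f = "(+)"] sum.cong refl) (simp add: Suc.IH)
      finally show ?thesis .
    qed
    have "(\<integral>\<^sup>+\<omega>. stopped_cost V c y (Suc n) x \<omega> \<partial>stream_space step_law)
        = (\<integral>\<^sup>+p. c p + (\<Sum>z\<in>V. if snd p x = z then ennreal (approx_hit y n z) else 0) \<partial>step_law)"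
      by (subst nn_integral_stream_space) (simp_all only: inner measurable_stopped_cost[OF c])
    also have "\<dots> = 1 + (\<Sum>z\<in>V. ennreal (trans_mat K x z) * ennreal (approx_hit y n z))"
      by (subst nn_integral_add) (auto simp: nn_integral_sum c1 nn_integral_step_target[OF Suc.prems])
    also have "\<dots> = ennreal (approx_hit y (Suc n) x)"
      using False by (simp add: ennreal_plus sum_nonneg trans_mat_nonneg approx_hit_nonneg flip: ennreal_mult sum_ennreal ennreal_1)
    finally show ?thesis .
  qed simp
qed (simp add: stopped_cost_0)

lemma approx_hit_mono: "approx_hit y n x \<le> approx_hit y (Suc n) x"
proof (induction n arbitrary: x)
  case (Suc n)
  show ?case
    by (subst (1 2) approx_hit.simps(2))
      (use Suc in \<open>auto intro!: sum_mono mult_left_mono trans_mat_nonneg simp del: approx_hit.simps\<close>)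
qed simp

text \<open>\<open>u\<close> is minus the column of the pseudo-inverse of \<open>I - P\<close> at \<open>y\<close>, up to normalisation.\<close>

lemma hitting_supersolution:
  assumes y: "y \<in> V"
  obtains w where "\<And>x. x \<in> V \<Longrightarrow> 0 \<le> w x"
    "\<And>x. x \<in> V \<Longrightarrow> x \<noteq> y \<Longrightarrow> 1 + (\<Sum>z\<in>V. trans_mat K x z * w z) \<le> w x"
proof -
  define u where "u x = (\<Sum>e\<in>modes. (- e y / eigval e) * e x)" for x
  \<comment> \<open>Applying \<open>I - P\<close> cancels the eigenvalues; by
    \<open>completeness\<close> the sum of \<open>e x * e y\<close> over the modes is -1 when
    \<open>x \<noteq> y\<close>.\<close>
  have lap_u: "ap u x = 1" if x: "x \<in> V" "x \<noteq> y" for x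
  proof -
    have "ap u x = (\<Sum>e\<in>modes. (- e y / eigval e) * ap e x)"
      unfolding u_def by (simp only: ap_sum ap_scale)
    also have "\<dots> = (\<Sum>e\<in>modes. - (e x * e y))"
      using eigval_mode_pos by (intro sum.cong refl) (force simp: ap_mode[OF _ x(1)])
    finally have "ap u x = - (\<Sum>e\<in>modes. e x * e y)" by (simp add: sum_negf)
    moreover have "pmf \<pi> y * (1 + (\<Sum>e\<in>modes. e x * e y)) = 0"
      using completeness[OF x(1) y] x y
      by (simp add: sum_eigenbasis unit_def algebra_simps sum_distrib_left)
    ultimately show ?thesis using \<pi>_pos[OF y] by simp
  qed
  \<comment> \<open>Adding a constant makes the function nonnegative and leaves \<open>I - P\<close>
    of it unchanged.\<close>
  define c where "c = (\<Sum>x\<in>V. \<bar>u x\<bar>)"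
  show thesis
  proof (rule that[of "\<lambda>x. u x + c"])
    show "0 \<le> u x + c" if "x \<in> V" for x
      using member_le_sum[of x V "\<lambda>x. \<bar>u x\<bar>"] that finite_V by (auto simp: c_def)
    show "1 + (\<Sum>z\<in>V. trans_mat K x z * (u z + c)) \<le> u x + c" if "x \<in> V" "x \<noteq> y" for x
      using lap_u[OF that] that
      by (simp add: ap_laplacian distrib_left sum.distrib sum_trans_mat flip: sum_distrib_right)
  qed
qed

text \<open>Comparison principle: the iteration starts at 0, below the supersolution, and is
  monotone, so it stays below.\<close>

lemma approx_hit_bounded:
  assumes y: "y \<in> V"
  obtains w where "\<And>x n. x \<in> V \<Longrightarrow> approx_hit y n x \<le> w x" "\<And>x. x \<in> V \<Longrightarrow> 0 \<le> w x"
proof -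
  obtain w where w: "\<And>x. x \<in> V \<Longrightarrow> 0 \<le> w x"
    "\<And>x. x \<in> V \<Longrightarrow> x \<noteq> y \<Longrightarrow> 1 + (\<Sum>z\<in>V. trans_mat K x z * w z) \<le> w x"
    using hitting_supersolution[OF y] by blast
  have "approx_hit y n x \<le> w x" if "x \<in> V" for x n using that
  proof (induction n arbitrary: x)
    case (Suc n)
    have "(\<Sum>z\<in>V. trans_mat K x z * approx_hit y n z) \<le> (\<Sum>z\<in>V. trans_mat K x z * w z)"
      by (intro sum_mono mult_left_mono trans_mat_nonneg Suc.IH)
    thus ?case using w(1,2)[OF Suc.prems] by (cases "x = y") auto
  qed (simp add: w)
  thus thesis using that w(1) by blast
qed

lemma AE_path_space:
  "AE \<omega> in path_space V K. (\<forall>k. 0 < fst (\<omega> !! k)) \<and> (\<forall>k. \<forall>z\<in>V. snd (\<omega> !! k) z \<in> V)"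
proof -
  interpret prob_space step_law by (rule prob_space_step_law)
  interpret E: prob_space hold_law by (rule prob_space_hold_law)
  interpret pair_sigma_finite hold_law "measure_pmf (Pi_pmf V undefined K)" ..
  have m[measurable]: "(\<lambda>p. snd p z) \<in> measurable step_law (count_space UNIV)" for z
    by (rule measurable_compose[OF measurable_snd]) simp
  have pred[measurable]: "Measurable.pred step_law (\<lambda>p. 0 < fst p \<and> (\<forall>z\<in>V. snd p z \<in> V))"
  proof -
    have [measurable]: "Measurable.pred step_law (\<lambda>p. snd p z \<in> V)" for z
      by (rule measurable_compose[OF m]) simp
    show ?thesis using finite_V by measurable
  qed
  have "AE s in hold_law. 0 < s"
  proof -
    \<comment> \<open>The density vanishes only on negative numbers, so the null point 0 is excluded
      separately.\<close>
    have "AE s in lborel. s \<noteq> (0::real)" by (rule AE_lborel_singleton)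
    thus ?thesis by (subst AE_density) (auto simp: erlang_density_def elim!: eventually_mono)
  qed
  moreover have "AE F in measure_pmf (Pi_pmf V undefined K). \<forall>z\<in>V. F z \<in> V"
    using K_closed finite_V by (force simp: AE_measure_pmf_iff set_Pi_pmf PiE_dflt_def)
  ultimately have "AE p in step_law. 0 < fst p \<and> (\<forall>z\<in>V. snd p z \<in> V)"
    by (intro AE_pair_measure) (use pred in \<open>auto elim!: eventually_mono simp: pred_def\<close>)
  hence "AE \<omega> in stream_space step_law. stream_all (\<lambda>p. 0 < fst p \<and> (\<forall>z\<in>V. snd p z \<in> V)) \<omega>"
    by (intro AE_stream_all) measurable
  thus ?thesis unfolding path_space_def
    by eventually_elim (auto simp: stream.pred_set sset_range)
qed

text \<open>Monotone convergence gives the same limit \<open>h\<close> for both costs. Unit cost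
  yields a finite expected jump count, so \<open>y\<close> is reached almost surely; holding times
  as cost then yield the expected hitting time.\<close>

lemma approx_hit_tendsto:
  assumes x: "x \<in> V" and y: "y \<in> V"
  shows "(\<lambda>n. approx_hit y n x) \<longlonglongrightarrow> expected_hitting_time V K x y"
proof -
  obtain w where w: "\<And>x n. x \<in> V \<Longrightarrow> approx_hit y n x \<le> w x" "\<And>x. x \<in> V \<Longrightarrow> 0 \<le> w x"
    using approx_hit_bounded[OF y] by blast
  have inc: "incseq (\<lambda>n. approx_hit y n x)" by (intro incseq_SucI approx_hit_mono)
  have "Bseq (\<lambda>n. approx_hit y n x)"
    using w(1)[OF x] approx_hit_nonneg by (intro BseqI'[where K = "w x"]) simp
  then obtain h where h: "(\<lambda>n. approx_hit y n x) \<longlonglongrightarrow> h"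
    using inc Bseq_mono_convergent unfolding convergent_def incseq_def by blast
  have h0: "0 \<le> h" using h approx_hit_nonneg by (intro LIMSEQ_le_const) auto
  have integral: "(\<integral>\<^sup>+\<omega>. (SUP n. stopped_cost V c y n x \<omega>) \<partial>path_space V K) = ennreal h"
    if c[measurable]: "c \<in> borel_measurable step_law" and c1: "(\<integral>\<^sup>+p. c p \<partial>step_law) = 1" for c
  proof -
    have "(\<integral>\<^sup>+\<omega>. (SUP n. stopped_cost V c y n x \<omega>) \<partial>path_space V K)
        = (SUP n. \<integral>\<^sup>+\<omega>. stopped_cost V c y n x \<omega> \<partial>path_space V K)"
      unfolding path_space_def
      by (rule nn_integral_monotone_convergence_SUP)
        (auto intro!: incseq_SucI le_funI stopped_cost_mono measurable_stopped_cost c)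
    also have "\<dots> = (SUP n. ennreal (approx_hit y n x))"
      unfolding path_space_def using nn_integral_stopped_cost[OF c c1 x] by simp
    also have "\<dots> = ennreal h"
    proof (rule LIMSEQ_unique)
      show "(\<lambda>n. ennreal (approx_hit y n x)) \<longlonglongrightarrow> (SUP n. ennreal (approx_hit y n x))"
        using inc by (intro LIMSEQ_SUP) (auto simp: incseq_def intro!: ennreal_leI)
      show "(\<lambda>n. ennreal (approx_hit y n x)) \<longlonglongrightarrow> ennreal h"
        using h by (rule tendsto_ennrealI)
    qed
    finally show ?thesis .
  qed
  have m: "(\<lambda>\<omega>. SUP n. stopped_cost V (\<lambda>_. 1) y n x \<omega>) \<in> borel_measurable (path_space V K)"
    unfolding path_space_def by (intro borel_measurable_SUP measurable_stopped_cost) auto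
  have "(\<integral>\<^sup>+p. 1 \<partial>step_law) = 1"
    using prob_space.emeasure_space_1[OF prob_space_step_law] by simp
  from integral[OF _ this] have "(\<integral>\<^sup>+\<omega>. (SUP n. stopped_cost V (\<lambda>_. 1) y n x \<omega>) \<partial>path_space V K) \<noteq> \<infinity>"
    by simp
  from nn_integral_PInf_AE[OF m this]
  have "AE \<omega> in path_space V K. (SUP n. stopped_cost V (\<lambda>_. 1) y n x \<omega>) \<noteq> \<infinity>" .
  with AE_path_space have "AE \<omega> in path_space V K.
      hitting_time x y \<omega> = (SUP n. stopped_cost V (\<lambda>p. ennreal (fst p)) y n x \<omega>)"
    by eventually_elim (intro hitting_time_eq_SUP finite_V x, auto)
  hence "(\<integral>\<^sup>+\<omega>. hitting_time x y \<omega> \<partial>path_space V K)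
      = (\<integral>\<^sup>+\<omega>. (SUP n. stopped_cost V (\<lambda>p. ennreal (fst p)) y n x \<omega>) \<partial>path_space V K)"
    by (rule nn_integral_cong_AE)
  also have "\<dots> = ennreal h"
    by (rule integral) (auto simp: nn_integral_step_law_fst[of ennreal] nn_integral_hold_law)
  finally show ?thesis using h h0 by (simp add: expected_hitting_time_def)
qed

section \<open>First-step equations and the eigentime identity\<close>

lemma expected_hitting_time_self:
  assumes "y \<in> V"
  shows "expected_hitting_time V K y y = 0"
proof (rule LIMSEQ_unique[OF approx_hit_tendsto[OF assms assms]])
  have "approx_hit y n y = 0" for n by (cases n) auto
  thus "(\<lambda>n. approx_hit y n y) \<longlonglongrightarrow> 0" by simp
qed

lemma expected_hitting_time_step:
  assumes x: "x \<in> V" and y: "y \<in> V" and ne: "x \<noteq> y"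
  shows "expected_hitting_time V K x y = 1 + (\<Sum>z\<in>V. trans_mat K x z * expected_hitting_time V K z y)"
proof (rule LIMSEQ_unique)
  show "(\<lambda>n. approx_hit y (Suc n) x) \<longlonglongrightarrow> expected_hitting_time V K x y"
    using approx_hit_tendsto[OF x y] by (rule LIMSEQ_Suc)
  show "(\<lambda>n. approx_hit y (Suc n) x) \<longlonglongrightarrow>
      1 + (\<Sum>z\<in>V. trans_mat K x z * expected_hitting_time V K z y)"
    using ne y by (auto intro!: tendsto_intros approx_hit_tendsto)
qed

lemma hitting_time_eigenexpansion:
  assumes y: "y \<in> V"
  shows "expected_hitting_time_from V K \<pi> y = (\<Sum>e\<in>modes. (e y)\<^sup>2 / eigval e)"
proof -
  define h where "h = (\<lambda>x. expected_hitting_time V K x y)"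
  \<comment> \<open>The first-step equation fails only at \<open>y\<close>, by the amount
    \<open>a\<close>. As \<open>I - P\<close> has range of mean zero,
    \<open>a = - 1 / pmf \<pi> y\<close>, which is Kac's formula.\<close>
  define a where "a = ap h y - 1"
  have "ap h x = 1" if "x \<in> V" "x \<noteq> y" for x
    using expected_hitting_time_step[OF that(1) y that(2)] that by (simp add: h_def ap_laplacian)
  hence lap: "ap h x = 1 + (if x = y then a else 0)" if "x \<in> V" for x
    using that by (auto simp: a_def)
  have ip_h: "ip (ap h) f = ip unit f + pmf \<pi> y * a * f y" for f
  proof -
    have "ip (ap h) f = ip (\<lambda>x. unit x + (if x = y then a else 0)) f"
      by (rule ip_cong) (auto simp: lap unit_def)
    thus ?thesis by (simp add: ip_add_left ip_point[OF y])
  qed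
  have "pmf \<pi> y * a = - 1"
    using ip_h[of unit] ip_unit_unit ip_ap_unit[of h] y by (simp add: unit_def)
  hence ip_h': "ip h e = - (e y / eigval e)" if e: "e \<in> modes" for e
  proof -
    have "eigval e * ip h e = ip h (\<lambda>x. eigval e * e x)" by (simp add: ip_scale_right)
    also have "\<dots> = ip h (ap e)" by (rule ip_cong) (auto simp: ap_mode[OF e])
    also have "\<dots> = ip (ap h) e" by (simp add: ap_self_adjoint)
    also have "\<dots> = - e y"
      using ip_mode_unit[OF e] \<open>pmf \<pi> y * a = - 1\<close> by (simp add: ip_h ip_commute[of unit])
    finally show ?thesis using eigval_mode_pos[OF e] by (simp add: field_simps)
  qed
  \<comment> \<open>Evaluating the expansion at \<open>y\<close>, where \<open>h\<close> vanishes,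
    isolates the mean of \<open>h\<close>.\<close>
  have "ip h unit = h y - (\<Sum>e\<in>modes. ip h e * e y)" using expansion[OF y, of h] by simp
  also have "\<dots> = (\<Sum>e\<in>modes. (e y)\<^sup>2 / eigval e)"
    by (simp add: h_def expected_hitting_time_self[OF y] ip_h'[unfolded h_def] power2_eq_square
        flip: sum_negf)
  finally show ?thesis
    by (simp add: ip_unit expected_hitting_time_from_def h_def)
qed

lemma t_odot_eigentime: "t_odot V K \<pi> = (\<Sum>e\<in>modes. 1 / eigval e)"
proof -
  have "t_odot V K \<pi> = (\<Sum>y\<in>V. \<Sum>e\<in>modes. pmf \<pi> y * e y * e y / eigval e)"
    unfolding t_odot_def
    by (intro sum.cong refl) (simp add: hitting_time_eigenexpansion sum_distrib_left power2_eq_square mult_ac)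
  also have "\<dots> = (\<Sum>e\<in>modes. ip e e / eigval e)"
    by (subst sum.swap) (simp add: ip_def sum_divide_distrib)
  finally show ?thesis by (simp add: ip_mode_self)
qed

subsection \<open>Comparison of relaxation, mixing and hitting times\<close>

lemma t_rel_pos: "0 < t_rel V K"
  using spectral_gap_pos by (simp add: t_rel_def)

lemma t_rel_le_t_odot: "t_rel V K \<le> t_odot V K \<pi>"
proof -
  obtain e where e: "e \<in> modes" "eigval e = spectral_gap V K" using spectral_gap_attained by blast
  have "1 / eigval e \<le> (\<Sum>e\<in>modes. 1 / eigval e)"
    using e(1) finite_modes eigval_mode_pos by (intro member_le_sum) (auto intro: less_imp_le)
  thus ?thesis by (simp add: t_odot_eigentime t_rel_def e(2))
qed

lemma expected_hitting_time_le_t_hit: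
  assumes "x \<in> V" "y \<in> V"
  shows "expected_hitting_time V K x y \<le> t_hit V K"
proof -
  have "{expected_hitting_time V K x y | x y. x \<in> V \<and> y \<in> V}
      = (\<lambda>(x, y). expected_hitting_time V K x y) ` (V \<times> V)" by auto
  thus ?thesis unfolding t_hit_def using assms finite_V by (intro Max_ge) auto
qed

lemma average_le:
  assumes "\<And>x. x \<in> V \<Longrightarrow> f x \<le> b"
  shows "(\<Sum>x\<in>V. pmf \<pi> x * f x) \<le> b"
proof -
  have "(\<Sum>x\<in>V. pmf \<pi> x * f x) \<le> (\<Sum>x\<in>V. pmf \<pi> x * b)"
    by (intro sum_mono mult_left_mono assms) auto
  thus ?thesis by (simp add: sum_\<pi> flip: sum_distrib_right)
qed

lemma expected_hitting_time_from_le_t_hit: "y \<in> V \<Longrightarrow> expected_hitting_time_from V K \<pi> y \<le> t_hit V K"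
  unfolding expected_hitting_time_from_def by (intro average_le expected_hitting_time_le_t_hit)

lemma t_odot_le_t_hit: "t_odot V K \<pi> \<le> t_hit V K"
  unfolding t_odot_def by (intro average_le expected_hitting_time_from_le_t_hit)

text \<open>
  By \<open>exp (- z) \<le> 2 / z\<^sup>2\<close> and \<open>eigval e * t_rel V K \<ge> 1\<close>, at time \<open>2 s \<surd>(t_rel H)\<close> every mode is
  damped at least to \<open>1 / (2 s\<^sup>2 H)\<close> times its contribution \<open>1 / eigval e\<close> to the hitting time.
\<close>

lemma mode_decay:
  assumes e: "e \<in> modes" and H: "0 < H" and s: "0 < s"
  shows "exp (- (2 * s * sqrt (t_rel V K * H) * eigval e)) \<le> 1 / (2 * s\<^sup>2 * H) * (1 / eigval e)"
proof -
  note l = eigval_mode_pos[OF e]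
  define z where "z = 2 * s * sqrt (t_rel V K * H) * eigval e"
  have R: "0 < t_rel V K" by (rule t_rel_pos)
  have z: "0 < z" using l s R H by (simp add: z_def)
  have "z\<^sup>2 / 2 \<le> exp z" using exp_lower_Taylor_quadratic[of z] z by simp
  hence "exp (- z) \<le> 2 / z\<^sup>2" using z by (simp add: exp_minus field_simps)
  also have "z\<^sup>2 = 4 * s\<^sup>2 * H * eigval e * (eigval e * t_rel V K)"
    using R H by (simp add: z_def power_mult_distrib power2_eq_square mult_ac)
  also have "2 / (4 * s\<^sup>2 * H * eigval e * (eigval e * t_rel V K)) \<le> 2 / (4 * s\<^sup>2 * H * eigval e * 1)"
  proof (rule divide_left_mono)
    have "1 \<le> eigval e * t_rel V K"
      using spectral_gap_le[OF e] spectral_gap_pos by (simp add: t_rel_def field_simps)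
    thus "4 * s\<^sup>2 * H * eigval e * 1 \<le> 4 * s\<^sup>2 * H * eigval e * (eigval e * t_rel V K)"
      using H s l by (intro mult_left_mono) auto
  qed (use H s l R in auto)
  finally show ?thesis by (simp add: z_def mult_ac)
qed

text \<open>One term of the trace, the slowest mode, already gives the bound. The parameter
  \<open>a\<close> is \<open>ln 2\<close> for uniform mixing and \<open>2 * ln 2\<close>, at doubled
  time, for average mixing.\<close>

lemma trace_lower_bound:
  assumes "(\<Sum>x\<in>V. heat_kernel V K t x x) \<le> 1 + exp (- a)"
  shows "a * t_rel V K \<le> t"
proof -
  obtain e where e: "e \<in> modes" "eigval e = spectral_gap V K" using spectral_gap_attained by blast
  have "exp (- (t * eigval e)) \<le> (\<Sum>e\<in>modes. exp (- (t * eigval e)))"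
    using e(1) finite_modes by (intro member_le_sum) auto
  also have "\<dots> \<le> exp (- a)" using assms by (simp add: heat_trace)
  finally have "a \<le> t * spectral_gap V K" by (simp add: e(2))
  thus ?thesis using spectral_gap_pos by (simp add: t_rel_def field_simps)
qed

definition mixed :: "real \<Rightarrow> bool" where
  "mixed t \<longleftrightarrow> Max {\<bar>heat_kernel V K t a b / pmf \<pi> b - 1\<bar> | a b. a \<in> V \<and> b \<in> V} \<le> 1 / 2"

lemma mixed_iff:
  "mixed t \<longleftrightarrow> (\<forall>a\<in>V. \<forall>b\<in>V. \<bar>heat_kernel V K t a b / pmf \<pi> b - 1\<bar> \<le> 1 / 2)"
proof -
  have eq: "{\<bar>heat_kernel V K t a b / pmf \<pi> b - 1\<bar> | a b. a \<in> V \<and> b \<in> V}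
      = (\<lambda>(a, b). \<bar>heat_kernel V K t a b / pmf \<pi> b - 1\<bar>) ` (V \<times> V)" by auto
  have "V \<noteq> {}" using card_V by auto
  thus ?thesis unfolding mixed_def eq using finite_V by (subst Max_le_iff) auto
qed

lemma heat_kernel_deviation:
  assumes a: "a \<in> V" and b: "b \<in> V"
  shows "heat_kernel V K t a b / pmf \<pi> b - 1 = (\<Sum>e\<in>modes. exp (- (t * eigval e)) * (e a * e b))"
  using \<pi>_pos[OF b] by (simp add: heat_kernel_spectral[OF a b])

text \<open>Averaging the diagonal deviations against \<pi> turns uniform mixing into a bound on the
  trace.\<close>

lemma mixed_lower_bound:
  assumes "mixed t"
  shows "ln 2 * t_rel V K \<le> t"
proof (rule trace_lower_bound)
  have "(\<Sum>x\<in>V. heat_kernel V K t x x) - 1 = (\<Sum>x\<in>V. pmf \<pi> x * (heat_kernel V K t x x / pmf \<pi> x - 1))"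
    using \<pi>_pos by (simp add: right_diff_distrib sum_subtractf sum_\<pi> less_imp_neq[symmetric] cong: sum.cong)
  also have "\<dots> \<le> 1 / 2"
  proof (rule average_le)
    show "heat_kernel V K t x x / pmf \<pi> x - 1 \<le> 1 / 2" if "x \<in> V" for x
      using assms that unfolding mixed_iff by (meson abs_le_D1)
  qed
  finally show "(\<Sum>x\<in>V. heat_kernel V K t x x) \<le> 1 + exp (- ln 2)" by (simp add: exp_minus)
qed

text \<open>On the diagonal, \<open>mode_decay\<close> compares the deviation with the
  eigenexpansion of a hitting time, at most \<open>t_hit\<close>. Off the diagonal, the product
  \<open>e a * e b\<close> is bounded by the mean of the two squares.\<close>

lemma mixed_upper_bound: "mixed (2 * sqrt (t_rel V K * t_hit V K))"
  unfolding mixed_iff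
proof (intro ballI)
  fix a b assume a: "a \<in> V" and b: "b \<in> V"
  define H where "H = t_hit V K"
  have H: "0 < H" using t_rel_pos t_rel_le_t_odot t_odot_le_t_hit by (simp add: H_def)
  define r where "r e = exp (- (2 * sqrt (t_rel V K * H) * eigval e))" for e
  have diag: "(\<Sum>e\<in>modes. r e * (e x)\<^sup>2) \<le> 1 / 2" if x: "x \<in> V" for x
  proof -
    have "(\<Sum>e\<in>modes. r e * (e x)\<^sup>2) \<le> (\<Sum>e\<in>modes. 1 / (2 * H) * (1 / eigval e) * (e x)\<^sup>2)"
      using mode_decay[OF _ H, of _ 1] by (intro sum_mono mult_right_mono) (auto simp: r_def)
    also have "\<dots> = 1 / (2 * H) * expected_hitting_time_from V K \<pi> x"
      by (simp add: hitting_time_eigenexpansion[OF x] sum_distrib_left)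
    also have "\<dots> \<le> 1 / (2 * H) * H"
      using expected_hitting_time_from_le_t_hit[OF x] H by (intro mult_left_mono) (auto simp: H_def)
    finally show ?thesis using H by simp
  qed
  have "\<bar>\<Sum>e\<in>modes. r e * (e a * e b)\<bar> \<le> (\<Sum>e\<in>modes. \<bar>r e * (e a * e b)\<bar>)" by (rule sum_abs)
  also have "\<dots> \<le> (\<Sum>e\<in>modes. (r e * (e a)\<^sup>2 + r e * (e b)\<^sup>2) / 2)"
  proof (rule sum_mono)
    fix e :: "'a \<Rightarrow> real"
    have "2 * \<bar>e a\<bar> * \<bar>e b\<bar> \<le> (e a)\<^sup>2 + (e b)\<^sup>2" using sum_squares_bound[of "\<bar>e a\<bar>" "\<bar>e b\<bar>"] by simp
    hence "r e * (2 * \<bar>e a\<bar> * \<bar>e b\<bar>) \<le> r e * ((e a)\<^sup>2 + (e b)\<^sup>2)"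
      by (rule mult_left_mono) (simp add: r_def)
    thus "\<bar>r e * (e a * e b)\<bar> \<le> (r e * (e a)\<^sup>2 + r e * (e b)\<^sup>2) / 2"
      by (simp add: abs_mult r_def algebra_simps)
  qed
  also have "\<dots> \<le> 1 / 2"
    using diag[OF a] diag[OF b] by (simp add: sum.distrib flip: sum_divide_distrib)
  finally show "\<bar>heat_kernel V K (2 * sqrt (t_rel V K * t_hit V K)) a b / pmf \<pi> b - 1\<bar> \<le> 1 / 2"
    by (simp add: heat_kernel_deviation[OF a b] r_def H_def)
qed

lemma t_mix_inf_bounds:
  "ln 2 * t_rel V K \<le> t_mix_inf V K \<pi>" "t_mix_inf V K \<pi> \<le> 2 * sqrt (t_rel V K * t_hit V K)"
proof -
  have nonneg: "0 \<le> t_rel V K * t_hit V K"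
    using t_rel_pos t_rel_le_t_odot t_odot_le_t_hit by simp
  hence mem: "2 * sqrt (t_rel V K * t_hit V K) \<in> {t. 0 \<le> t \<and> mixed t}"
    using mixed_upper_bound by simp
  have eq: "t_mix_inf V K \<pi> = Inf {t. 0 \<le> t \<and> mixed t}"
    by (simp add: t_mix_inf_def mixed_def)
  show "ln 2 * t_rel V K \<le> t_mix_inf V K \<pi>"
    unfolding eq by (rule cInf_greatest) (use mem mixed_lower_bound in blast)+
  show "t_mix_inf V K \<pi> \<le> 2 * sqrt (t_rel V K * t_hit V K)"
    unfolding eq by (rule cInf_lower[OF mem]) (auto intro!: bdd_belowI[of _ 0])
qed

lemma t_ave_mix_2_bounds:
  "ln 2 * t_rel V K \<le> t_ave_mix_2 V K" "t_ave_mix_2 V K \<le> 2 * sqrt (t_rel V K * t_odot V K \<pi>)"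
proof -
  define H where "H = t_odot V K \<pi>"
  have H: "0 < H" using t_rel_pos t_rel_le_t_odot by (simp add: H_def)
  let ?T = "2 * sqrt (t_rel V K * H)"
  let ?S = "{t. 0 \<le> t \<and> (\<Sum>x\<in>V. heat_kernel V K (2 * t) x x) \<le> 1 + 1 / 4}"
  \<comment> \<open>The trace is taken at time \<open>2 * ?T\<close>, so \<open>mode_decay\<close>
    applies with \<open>s = 2\<close>, whence the factor \<open>1 / (8 * H)\<close>.\<close>
  have "(\<Sum>e\<in>modes. exp (- (2 * ?T * eigval e))) \<le> (\<Sum>e\<in>modes. 1 / (8 * H) * (1 / eigval e))"
    using mode_decay[OF _ H, of _ 2] by (intro sum_mono) simp
  also have "\<dots> = 1 / (8 * H) * H"
    by (simp only: H_def t_odot_eigentime sum_distrib_left)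
  also have "\<dots> \<le> 1 / 4" using H by simp
  finally have mem: "?T \<in> ?S"
    using H t_rel_pos by (simp add: heat_trace)
  have low: "ln 2 * t_rel V K \<le> t" if "t \<in> ?S" for t
  proof -
    have "exp (- (2 * ln 2)) = (1 / 4 :: real)"
      using exp_of_nat_mult[of 2 "ln 2 :: real"] by (simp add: exp_minus)
    hence "(2 * ln 2) * t_rel V K \<le> 2 * t"
      using that by (intro trace_lower_bound) simp
    thus ?thesis by simp
  qed
  show "ln 2 * t_rel V K \<le> t_ave_mix_2 V K"
    unfolding t_ave_mix_2_def by (rule cInf_greatest) (use mem low in blast)+
  show "t_ave_mix_2 V K \<le> 2 * sqrt (t_rel V K * t_odot V K \<pi>)"
    unfolding t_ave_mix_2_def H_def[symmetric] by (rule cInf_lower[OF mem]) (auto intro!: bdd_belowI[of _ 0])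
qed

end

text \<open>With \<open>r = R / H\<close> and \<open>m = M / H\<close> the hypotheses read
  \<open>ln 2 * r \<le> m \<le> 2 * sqrt r\<close> and \<open>r \<le> 1\<close>. So \<open>m\<close>
  is bounded away from 0, or tends to 0, exactly when \<open>r\<close> does.\<close>

lemma orders_equivalent:
  fixes R M H :: "nat \<Rightarrow> real"
  assumes R: "\<And>n. 0 < R n" and RH: "\<And>n. R n \<le> H n"
    and low: "\<And>n. ln 2 * R n \<le> M n" and up: "\<And>n. M n \<le> 2 * sqrt (R n * H n)"
  shows "same_order M H \<longleftrightarrow> same_order R H" "much_less M H \<longleftrightarrow> much_less R H"
proof -
  have H: "0 < H n" for n using R[of n] RH[of n] by linarith
  have up2: "M n \<le> 2 * H n" for n
  proof -
    have "sqrt (R n * H n) \<le> sqrt (H n * H n)"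
      using RH H by (intro real_sqrt_le_mono mult_right_mono) (auto intro: less_imp_le)
    thus ?thesis using up[of n] H[of n] by simp
  qed
  have M: "0 < M n" for n using low[of n] R[of n] by (smt (verit) ln_gt_zero mult_pos_pos)
  show "same_order M H \<longleftrightarrow> same_order R H"
  proof
    assume "same_order M H"
    then obtain C where C: "0 < C" "\<And>n. inverse C * H n \<le> M n" by (auto simp: same_order_def)
    \<comment> \<open>Square \<open>inverse C * H n \<le> 2 * sqrt (R n * H n)\<close> and cancel
      one factor \<open>H n\<close>.\<close>
    have "inverse (4 * C\<^sup>2) * H n \<le> R n" for n
    proof -
      have "(inverse C * H n)\<^sup>2 \<le> (2 * sqrt (R n * H n))\<^sup>2"
        using C(2)[of n] up[of n] C(1) H[of n] by (intro power_mono) auto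
      hence "(inverse C)\<^sup>2 * H n * H n \<le> 4 * R n * H n"
        using R[of n] H[of n] by (simp add: power_mult_distrib power2_eq_square mult_ac)
      hence "(inverse C)\<^sup>2 * H n \<le> 4 * R n" using H[of n] by (metis mult_le_cancel_right_pos)
      thus ?thesis using C(1) by (simp add: field_simps)
    qed
    \<comment> \<open>The constant must also be at least 1 for the upper bound, which comes from
      \<open>R n \<le> H n\<close>.\<close>
    hence "inverse (max 1 (4 * C\<^sup>2)) * H n \<le> R n \<and> R n \<le> max 1 (4 * C\<^sup>2) * H n" for n
    proof (intro conjI)
      have "inverse (max 1 (4 * C\<^sup>2)) * H n \<le> inverse (4 * C\<^sup>2) * H n"
        using C(1) H[of n] by (intro mult_right_mono le_imp_inverse_le) auto
      thus "inverse (max 1 (4 * C\<^sup>2)) * H n \<le> R n"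
        using \<open>\<And>n. inverse (4 * C\<^sup>2) * H n \<le> R n\<close>[of n] by linarith
      have "1 * H n \<le> max 1 (4 * C\<^sup>2) * H n" using H[of n] by (intro mult_right_mono) auto
      thus "R n \<le> max 1 (4 * C\<^sup>2) * H n" using RH[of n] by linarith
    qed
    thus "same_order R H" unfolding same_order_def by (intro exI[of _ "max 1 (4 * C\<^sup>2)"]) auto
  next
    assume "same_order R H"
    then obtain C where C: "0 < C" "\<And>n. inverse C * H n \<le> R n" by (auto simp: same_order_def)
    \<comment> \<open>The value 2 serves \<open>M n \<le> 2 * H n\<close>; \<open>C / ln 2\<close>
      serves the lower bound through \<open>ln 2 * R n \<le> M n\<close>.\<close>
    define D where "D = max 2 (C / ln 2)"
    have "inverse D * H n \<le> M n \<and> M n \<le> D * H n" for n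
    proof
      have "inverse D \<le> inverse (C / ln 2)" using C(1) by (intro le_imp_inverse_le) (auto simp: D_def)
      hence "inverse D * H n \<le> inverse (C / ln 2) * H n" using H[of n] by (intro mult_right_mono) auto
      also have "\<dots> = ln 2 * (inverse C * H n)" by (simp add: field_simps)
      also have "\<dots> \<le> ln 2 * R n" using C(2)[of n] by (intro mult_left_mono) auto
      finally show "inverse D * H n \<le> M n" using low[of n] by linarith
      have "2 * H n \<le> D * H n" using H[of n] by (intro mult_right_mono) (auto simp: D_def)
      thus "M n \<le> D * H n" using up2[of n] by linarith
    qed
    moreover have "0 < D" by (simp add: D_def)
    ultimately show "same_order M H" unfolding same_order_def by blast
  qed
  show "much_less M H \<longleftrightarrow> much_less R H"
    unfolding much_less_def
  proof
    assume "(\<lambda>n. M n / H n) \<longlonglongrightarrow> 0"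
    hence "(\<lambda>n. M n / H n / ln 2) \<longlonglongrightarrow> 0 / ln 2" by (intro tendsto_divide tendsto_const) auto
    hence lim: "(\<lambda>n. M n / H n / ln 2) \<longlonglongrightarrow> 0" by simp
    show "(\<lambda>n. R n / H n) \<longlonglongrightarrow> 0"
    proof (rule tendsto_sandwich[OF _ _ tendsto_const lim])
      show "\<forall>\<^sub>F n in sequentially. 0 \<le> R n / H n"
        using R H by (intro always_eventually allI) (simp add: less_imp_le)
      have "R n / H n \<le> M n / H n / ln 2" for n
        using low[of n] H[of n] by (simp add: field_simps)
      thus "\<forall>\<^sub>F n in sequentially. R n / H n \<le> M n / H n / ln 2" by simp
    qed
  next
    assume "(\<lambda>n. R n / H n) \<longlonglongrightarrow> 0"
    hence "(\<lambda>n. 2 * sqrt (R n / H n)) \<longlonglongrightarrow> 2 * sqrt 0" by (intro tendsto_intros)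
    hence lim: "(\<lambda>n. 2 * sqrt (R n / H n)) \<longlonglongrightarrow> 0" by simp
    show "(\<lambda>n. M n / H n) \<longlonglongrightarrow> 0"
    proof (rule tendsto_sandwich[OF _ _ tendsto_const lim])
      show "\<forall>\<^sub>F n in sequentially. 0 \<le> M n / H n"
        by (intro always_eventually allI divide_nonneg_nonneg less_imp_le M H)
      have "M n / H n \<le> 2 * sqrt (R n / H n)" for n
      proof -
        have "sqrt (R n * H n) = sqrt (R n / H n * (H n)\<^sup>2)"
          using H[of n] by (simp add: power2_eq_square)
        also have "\<dots> = sqrt (R n / H n) * H n" using H[of n] by (simp only: real_sqrt_mult) simp
        finally show ?thesis using up[of n] H[of n] by (simp add: field_simps)
      qed
      thus "\<forall>\<^sub>F n in sequentially. M n / H n \<le> 2 * sqrt (R n / H n)" by simp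
    qed
  qed
qed

theorem corollary1p1:
  fixes V :: "nat \<Rightarrow> 'a set" and K :: "nat \<Rightarrow> 'a \<Rightarrow> 'a pmf" and \<pi> :: "nat \<Rightarrow> 'a pmf"
  assumes "\<And>n. irreducible_reversible_chain (V n) (K n) (\<pi> n)"
  shows
    "(same_order (\<lambda>n. t_mix_inf (V n) (K n) (\<pi> n)) (\<lambda>n. t_hit (V n) (K n))
        \<longleftrightarrow> same_order (\<lambda>n. t_rel (V n) (K n)) (\<lambda>n. t_hit (V n) (K n)))
   \<and> (much_less (\<lambda>n. t_mix_inf (V n) (K n) (\<pi> n)) (\<lambda>n. t_hit (V n) (K n))
        \<longleftrightarrow> much_less (\<lambda>n. t_rel (V n) (K n)) (\<lambda>n. t_hit (V n) (K n)))
   \<and> (same_order (\<lambda>n. t_ave_mix_2 (V n) (K n)) (\<lambda>n. t_odot (V n) (K n) (\<pi> n))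
        \<longleftrightarrow> same_order (\<lambda>n. t_rel (V n) (K n)) (\<lambda>n. t_odot (V n) (K n) (\<pi> n)))
   \<and> (much_less (\<lambda>n. t_ave_mix_2 (V n) (K n)) (\<lambda>n. t_odot (V n) (K n) (\<pi> n))
        \<longleftrightarrow> much_less (\<lambda>n. t_rel (V n) (K n)) (\<lambda>n. t_odot (V n) (K n) (\<pi> n)))"
proof -
  have c: "reversible_chain (V n) (K n) (\<pi> n)" for n
    using assms by (rule reversible_chain.intro)
  note R = reversible_chain.t_rel_pos[OF c]
  note odot = reversible_chain.t_rel_le_t_odot[OF c]
  have hit: "t_rel (V n) (K n) \<le> t_hit (V n) (K n)" for n
    using odot reversible_chain.t_odot_le_t_hit[OF c] by (rule order_trans)
  show ?thesis
    \<comment> \<open>\<open>orders_equivalent\<close> is used with \<open>t_hit\<close> as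
      \<open>H\<close> for \<open>t_mix_inf\<close>, and with \<open>t_odot\<close> as
      \<open>H\<close> for \<open>t_ave_mix_2\<close>.\<close>
    by (intro conjI orders_equivalent R hit odot
        reversible_chain.t_mix_inf_bounds[OF c] reversible_chain.t_ave_mix_2_bounds[OF c])
qed

end
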